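(* Let $g_n\colon\mathbb{D}\to\mathbb{D}$, $n\in\mathbb{N}$, be inner functions with $g_n(0)=0$. Let $G_n = g_n\circ\cdots\circ g_1$ for $n\ge 1$, and $G_m^n = g_n\circ\cdots\circ g_{m+1}$ for $n>m\ge 0$. (a) The sequence $\{\widehat G_n\}_{n\in\mathbb{N}}$ is ergodic if, for all $\ell\in\mathbb{N}$, $$\lim_{N\to+\infty}\frac1N\sum_{m=1}^{N-1}\left((G_m^N)'(0)\right)^\ell=0.$$ (b) If the sequence $\{\widehat G_n\}_{n\in\mathbb{N}}$ is ergodic, then $$\lim_{N\to+\infty}\frac1N\sum_{n=m+1}^{N}\left((G_m^n)'(0)\right)^\ell=0$$ for every pair of integers $m\ge0$ and $\ell\ge1$.
   Context: $\mathbb{D}$ is the open unit disc in $\mathbb{C}$, $m$ (as a measure) is normalised Lebesgue measure on $\partial\mathbb{D}$, and $\mathbb{N}=\{1,2,3,\dots\}$. An analytic map $g\colon\mathbb{D}\to\mathbb{D}$ is inner if $\hat g(e^{i\theta})=\lim_{r\nearrow 1}g(re^{i\theta})$ exists and has modulus one for almost every $e^{i\theta}\in\partial\mathbb{D}$; $\hat g$ is its (a.e. defined) boundary map. If $g(0)=0$, then $\hat g$ preserves $m$. A sequence $\{T_n\}_{n\in\mathbb{N}}$ of measure-preserving maps of a probability space $(X,\mathcal{A},\mu)$ is called ergodic if $\lim_{N\to\infty}\left\|\frac1N\sum_{n=1}^N\varphi\circ T_n-\int_X\varphi\,d\mu\right\|_{2}=0$ for every complex-valued $\varphi\in L^2(\mu)$.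 For boundary maps this is applied with $(X,\mu)=(\partial\mathbb{D},m)$. *)

theory Defs
  imports "HOL-Complex_Analysis.Complex_Analysis" "HOL-Probability.Probability"
begin

text \<open>Normalised Lebesgue measure on the unit circle: the completion of the normalised
  arc-length measure on the Borel sets.\<close>

definition circle_measure :: "complex measure" where
  "circle_measure =
     completion (distr (uniform_measure lborel {0..<2 * pi}) (restrict_space borel (sphere 0 1)) cis)"

lemma space_circle_measure [simp]: "space circle_measure = sphere 0 1"
  by (simp add: circle_measure_def space_restrict_space)

lemma prob_space_circle_measure: "prob_space circle_measure"
proof -
  have "prob_space (uniform_measure lborel {0..<2 * pi})"
    by (rule prob_space_uniform_measure) auto
  moreover have "cis \<in> uniform_measure lborel {0..<2 * pi} \<rightarrow>\<^sub>M restrict_space borel (sphere 0 1)"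
  proof (rule measurable_restrict_space2)
    have "cis \<in> borel_measurable borel"
      by (intro borel_measurable_continuous_onI continuous_intros)
    then show "cis \<in> borel_measurable (uniform_measure lborel {0..<2 * pi})"
      by (simp cong: measurable_cong_sets)
  qed auto
  ultimately show ?thesis
    unfolding circle_measure_def
    by (intro prob_space.prob_space_completion prob_space.prob_space_distr)
qed

definition has_radial_limit :: "(complex \<Rightarrow> complex) \<Rightarrow> complex \<Rightarrow> complex \<Rightarrow> bool" where
  "has_radial_limit g \<zeta> w \<longleftrightarrow> ((\<lambda>r. g (complex_of_real r * \<zeta>)) \<longlongrightarrow> w) (at_left 1)"

definition inner_function :: "(complex \<Rightarrow> complex) \<Rightarrow> bool" where
  "inner_function g \<longleftrightarrow>
     g holomorphic_on ball 0 1 \<and> g \<in> ball 0 1 \<rightarrow> ball 0 1 \<and>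
     (AE \<zeta> in circle_measure. \<exists>w. has_radial_limit g \<zeta> w \<and> norm w = 1)"

text \<open>The boundary map is determined almost everywhere only.  At the exceptional points, where there is
  no radial limit of modulus one, it takes the value \<open>1\<close>, so that it maps the circle into itself.\<close>

definition boundary_map :: "(complex \<Rightarrow> complex) \<Rightarrow> complex \<Rightarrow> complex" where
  "boundary_map g \<zeta> =
     (if \<exists>w. has_radial_limit g \<zeta> w \<and> norm w = 1 then THE w. has_radial_limit g \<zeta> w else 1)"

definition measure_preserving_map :: "'a measure \<Rightarrow> ('a \<Rightarrow> 'a) \<Rightarrow> bool" where
  "measure_preserving_map M T \<longleftrightarrow> T \<in> M \<rightarrow>\<^sub>M M \<and> distr M M T = M"

definition square_integrable :: "'a measure \<Rightarrow> ('a \<Rightarrow> complex) \<Rightarrow> bool" where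
  "square_integrable M \<phi> \<longleftrightarrow>
     \<phi> \<in> borel_measurable M \<and> integrable M (\<lambda>x. (norm (\<phi> x))\<^sup>2)"

definition norm_L2 :: "'a measure \<Rightarrow> ('a \<Rightarrow> complex) \<Rightarrow> real" where
  "norm_L2 M \<phi> = sqrt (\<integral>x. (norm (\<phi> x))\<^sup>2 \<partial>M)"

text \<open>Sequences are indexed by \<open>n \<ge> 1\<close>; the value at index \<open>0\<close> plays no role.\<close>

definition ergodic_sequence :: "'a measure \<Rightarrow> (nat \<Rightarrow> 'a \<Rightarrow> 'a) \<Rightarrow> bool" where
  "ergodic_sequence M T \<longleftrightarrow>
     (\<forall>n\<ge>1. measure_preserving_map M (T n)) \<and>
     (\<forall>\<phi>. square_integrable M \<phi> \<longrightarrow>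
        (\<lambda>N. norm_L2 M (\<lambda>x. (\<Sum>n=1..N. \<phi> (T n x)) / of_nat N - (\<integral>y. \<phi> y \<partial>M)))
          \<longlonglongrightarrow> 0)"

text \<open>\<open>comp_seq g m n\<close> is \<open>g n \<circ> \<dots> \<circ> g (m + 1)\<close>, the map with the smallest index being applied first.\<close>

definition comp_seq :: "(nat \<Rightarrow> 'a \<Rightarrow> 'a) \<Rightarrow> nat \<Rightarrow> nat \<Rightarrow> 'a \<Rightarrow> 'a" where
  "comp_seq g m n = fold g [Suc m..<Suc n]"

lemma comp_seq_self [simp]: "comp_seq g n n = id"
  by (simp add: comp_seq_def id_def fun_eq_iff)

lemma comp_seq_Suc: "m \<le> n \<Longrightarrow> comp_seq g m (Suc n) = g (Suc n) \<circ> comp_seq g m n"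
  by (simp add: comp_seq_def fun_eq_iff)

end

theory Submission imports Defs begin

text \<open>Write \<open>G n\<close> for the composition of the first \<open>n\<close> maps, and \<open>X n\<close> for the \<open>l\<close>-th power of its boundary map.
  If \<open>h\<close> is the composition of the maps \<open>m + 1, \<dots>, n\<close>, then \<open>X n\<close> is the \<open>l\<close>-th power of the boundary map of \<open>h\<close>,
  evaluated along the boundary map of \<open>G m\<close>.  The latter preserves the measure, so the inner product of \<open>X n\<close>
  and \<open>X m\<close> is the \<open>l\<close>-th Fourier coefficient of the \<open>l\<close>-th power of \<open>h\<close>, which is the \<open>l\<close>-th power of the
  derivative of \<open>h\<close> at \<open>0\<close>, since \<open>h 0 = 0\<close>.
  Expanding the square of the norm of the averages of the \<open>X n\<close> gives (a) for trigonometric monomials, hence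
  for all square-integrable functions by density; pairing these averages with \<open>X m\<close> gives (b).

  Boundary maps compose almost everywhere, but this does not follow from the radial limits alone, as an inner
  function may approach its boundary value tangentially along a radius.  Instead \<open>h \<circ> f\<close> is written as
  the Poisson integral of the composed boundary maps, and Fatou's theorem (from the Lebesgue density theorem,
  by Vitali's covering theorem) is applied to it.\<close>

section \<open>Arc length on the circle and Cauchy's formula\<close>

text \<open>The numbers \<open>deriv (comp_seq g m n) 0 ^ l\<close> form a triangular array of
  correlations. The squared norm of an average is a double sum; grouped by its larger index
  \<open>n\<close> it contains the sums over \<open>m\<close> of (a). Pairing with one fixed
  \<open>m\<close> leaves the sums over \<open>n\<close> of (b). Hence the two conditions run along
  different directions of the array.

  Invariance of the measure is proved as well, and it has to precede composition:
  \<open>boundary_map h\<close> is controlled only off a null set, whose preimage under the boundary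
  map of \<open>f\<close> must again be null. The test functions are Poisson kernels, because their
  means along a boundary map can be computed by holomorphy. Symmetry and positivity of the kernel
  lead from there to an inequality for open sets, and outer regularity to Borel sets.

  Fatou's theorem serves a second purpose, the density argument: the Poisson means of a bounded
  function converge almost everywhere, hence in mean square, and each of them is a uniform limit of
  trigonometric polynomials.\<close>

abbreviation borel_circle :: "complex measure" where
  "borel_circle \<equiv> restrict_space borel (sphere 0 1)"

text \<open>The measure before completion: facts about Borel sets and Borel functions are settled
  here and then carried over to \<open>circle_measure\<close>.\<close>

definition circle_base :: "complex measure" where
  "circle_base = distr (uniform_measure lborel {0..<2 * pi}) borel_circle cis"

lemma circle_measure_eq: "circle_measure = completion circle_base"
  by (simp add: circle_measure_def circle_base_def)

lemma sets_circle_base [measurable_cong]: "sets circle_base = sets borel_circle"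
  by (simp add: circle_base_def)

lemma space_circle_base [simp]: "space circle_base = sphere 0 1"
  by (simp add: circle_base_def space_restrict_space)

lemma cis_borel [measurable]: "cis \<in> borel_measurable borel"
  by (intro borel_measurable_continuous_onI continuous_intros)

lemma cis_borel_circle: "cis \<in> borel \<rightarrow>\<^sub>M borel_circle"
  by (rule measurable_restrict_space2) auto

interpretation circle: prob_space circle_measure
  by (rule prob_space_circle_measure)

lemma borel_measurable_circleI:
  "f \<in> borel_circle \<rightarrow>\<^sub>M N \<Longrightarrow> f \<in> circle_measure \<rightarrow>\<^sub>M N"
  unfolding circle_measure_eq
  by (rule measurable_completion) (simp cong: measurable_cong_sets add: sets_circle_base)

lemma borel_measurable_circle_continuous:
  "continuous_on (sphere 0 1) f \<Longrightarrow> f \<in> borel_measurable circle_measure"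
  by (intro borel_measurable_circleI borel_measurable_continuous_on_restrict)

lemma borel_measurable_circle:
  "f \<in> borel \<rightarrow>\<^sub>M N \<Longrightarrow> f \<in> circle_measure \<rightarrow>\<^sub>M N"
  by (intro borel_measurable_circleI measurable_restrict_space1)

lemma circle_set_borel: "A \<in> sets borel \<Longrightarrow> A \<inter> sphere 0 1 \<in> sets circle_base"
  by (auto simp: sets_circle_base sets_restrict_space)

lemma AE_cisI:
  assumes "A \<in> sets borel" "AE t in lborel. t \<in> {0..<2*pi} \<longrightarrow> cis t \<in> A"
  shows "AE \<zeta> in circle_measure. \<zeta> \<in> A"
proof -
  have "AE t in uniform_measure lborel {0..<2*pi}. cis t \<in> A"
    by (rule AE_uniform_measureI) (use assms(2) in auto)
  then have "AE \<zeta> in circle_base. \<zeta> \<in> A"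
    unfolding circle_base_def
    by (subst AE_distr_iff)
       (use cis_borel_circle assms(1) in \<open>auto cong: measurable_cong_sets simp: sets_restrict_space space_restrict_space\<close>)
  then show ?thesis unfolding circle_measure_eq by (rule AE_completion)
qed

lemma integral_circle_measure:
  fixes f :: "complex \<Rightarrow> 'b::{banach, second_countable_topology}"
  assumes f: "f \<in> borel_measurable borel_circle"
  shows "(\<integral>\<zeta>. f \<zeta> \<partial>circle_measure) = (LINT t:{0..2*pi}|lborel. f (cis t)) /\<^sub>R (2*pi)"
proof -
  have fc: "(\<lambda>t. f (cis t)) \<in> borel_measurable borel"
    using measurable_compose[OF cis_borel_circle f] .
  have 1: "(\<integral>\<zeta>. f \<zeta> \<partial>circle_measure) = (\<integral>\<zeta>. f \<zeta> \<partial>circle_base)"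
    unfolding circle_measure_eq
    by (rule integral_completion) (use f in \<open>simp cong: measurable_cong_sets add: sets_circle_base\<close>)
  also have "\<dots> = (\<integral>t. f (cis t) \<partial>uniform_measure lborel {0..<2*pi})"
    unfolding circle_base_def
    by (rule integral_distr) (use cis_borel_circle f in \<open>simp_all cong: measurable_cong_sets\<close>)
  also have "uniform_measure lborel {0..<2*pi} = density lborel (\<lambda>t. ennreal (indicator {0..<2*pi} t / (2*pi)))"
    unfolding uniform_measure_def
    by (intro density_cong) (auto split: split_indicator simp: divide_ennreal[of 1, simplified])
  also have "(\<integral>t. f (cis t) \<partial>\<dots>) = (\<integral>t. (indicator {0..<2*pi} t / (2*pi)) *\<^sub>R f (cis t) \<partial>lborel)"
    by (rule integral_density) (use fc in auto)
  \<comment> \<open>Adding the null endpoint \<open>2 * pi\<close> gives the closed interval on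
    which contour integrals along \<open>circlepath\<close> are expressed.\<close>
  also have "\<dots> = (\<integral>t. (indicator {0..2*pi} t *\<^sub>R f (cis t)) /\<^sub>R (2*pi) \<partial>lborel)"
  proof (rule integral_cong_AE)
    show "AE t in lborel. (indicator {0..<2*pi} t / (2*pi)) *\<^sub>R f (cis t) = (indicator {0..2*pi} t *\<^sub>R f (cis t)) /\<^sub>R (2*pi)"
      using AE_lborel_singleton[of "2*pi"]
    proof eventually_elim
      fix t :: real assume "t \<noteq> 2*pi"
      then have "indicator {0..<2*pi} t = (indicator {0..2*pi} t :: real)"
        by (auto simp: indicator_def)
      then show "(indicator {0..<2*pi} t / (2*pi)) *\<^sub>R f (cis t) = (indicator {0..2*pi} t *\<^sub>R f (cis t)) /\<^sub>R (2*pi)"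
        by (simp only: scaleR_scaleR divide_inverse mult.commute)
    qed
  qed (use fc in measurable)
  also have "\<dots> = (LINT t:{0..2*pi}|lborel. f (cis t)) /\<^sub>R (2*pi)"
    unfolding set_lebesgue_integral_def by (rule integral_scaleR_right)
  finally show ?thesis .
qed

text \<open>Along \<open>cis\<close> the differential \<open>dw\<close> is
  \<open>\<i> * w * dt\<close>, so \<open>w / (w - z)\<close> against normalised arc length is
  Cauchy's kernel, and the factor \<open>2 * pi * \<i>\<close> cancels.\<close>

lemma cauchy_circle:
  assumes F: "continuous_on (cball 0 1) F" "F holomorphic_on ball 0 1" and z: "norm z < 1"
  shows "(\<integral>w. F w * w / (w - z) \<partial>circle_measure) = F z"
proof -
  have "((\<lambda>u. F u / (u - z)) has_contour_integral (2 * of_real pi * \<i> * F z)) (circlepath 0 1)"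
    by (rule Cauchy_integral_circlepath) (use F z in auto)
  then have "((\<lambda>t. F (cis t) / (cis t - z) * \<i> * cis t) has_integral (2 * of_real pi * \<i> * F z)) {0..2*pi}"
    unfolding circlepath_def by (subst (asm) has_contour_integral_part_circlepath_iff) auto
  then have A: "((\<lambda>t. (-\<i>) * (F (cis t) / (cis t - z) * \<i> * cis t)) has_integral (-\<i>) * (2 * of_real pi * \<i> * F z)) {0..2*pi}"
    by (rule has_integral_mult_right)
  have B: "(-\<i>) * (F (cis t) / (cis t - z) * \<i> * cis t) = F (cis t) * cis t / (cis t - z)" for t
    by (simp add: field_simps)
  have I: "((\<lambda>t. F (cis t) * cis t / (cis t - z)) has_integral (2 * of_real pi * F z)) {0..2*pi}"
  proof -
    have "(-\<i>) * (2 * of_real pi * \<i> * F z) = 2 * of_real pi * F z"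
      using i_squared by algebra
    then show ?thesis using A unfolding B by metis
  qed
  have nz: "w \<noteq> z" if "w \<in> sphere 0 1" for w using that z by auto
  have c: "continuous_on (sphere 0 1) (\<lambda>w. F w * w / (w - z))"
    by (intro continuous_intros continuous_on_subset[OF F(1)]) (use nz in auto)
  have cc: "continuous_on {0..2*pi} (\<lambda>t. F (cis t) * cis t / (cis t - z))"
    by (rule continuous_on_compose2[OF c]) (auto intro: continuous_intros)
  have si: "set_integrable lborel {0..2*pi} (\<lambda>t. F (cis t) * cis t / (cis t - z))"
    by (rule borel_integrable_atLeastAtMost') (rule cc)
  have "(LINT t:{0..2*pi}|lborel. F (cis t) * cis t / (cis t - z)) = 2 * of_real pi * F z"
    using set_borel_integral_eq_integral(2)[OF si] integral_unique[OF I] by simp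
  then have "(\<integral>w. F w * w / (w - z) \<partial>circle_measure) = (2 * of_real pi * F z) /\<^sub>R (2*pi)"
    using integral_circle_measure[of "\<lambda>w. F w * w / (w - z)"] c borel_measurable_continuous_on_restrict[OF c]
    by simp
  also have "\<dots> = F z" by (simp add: scaleR_conv_of_real)
  finally show ?thesis .
qed

section \<open>The Poisson kernel\<close>

lemma circle_integrable_bounded:
  fixes f :: "complex \<Rightarrow> 'b::{banach, second_countable_topology}"
  assumes "f \<in> borel_measurable circle_measure" "\<And>w. norm w = 1 \<Longrightarrow> norm (f w) \<le> B"
  shows "integrable circle_measure f"
  by (rule circle.integrable_const_bound[of _ B]) (use assms in \<open>auto intro!: AE_I2\<close>)

definition poisson :: "complex \<Rightarrow> complex \<Rightarrow> real" where
  "poisson z w = (1 - (norm z)\<^sup>2) / (norm (w - z))\<^sup>2"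

lemma poisson_measurable [measurable]: "poisson z \<in> borel_measurable borel"
  unfolding poisson_def by measurable

lemma poisson_measurable_circle [measurable]: "poisson z \<in> borel_measurable circle_measure"
  by (rule borel_measurable_circle) measurable

lemma poisson_nonneg: "norm z \<le> 1 \<Longrightarrow> 0 \<le> poisson z w"
  unfolding poisson_def by (intro divide_nonneg_nonneg) (auto simp: power_le_one)

lemma poisson_le:
  assumes "norm w = 1" "norm z < 1"
  shows "poisson z w \<le> 2 / (1 - norm z)"
proof -
  have a: "1 - norm z \<le> norm (w - z)"
    using norm_triangle_ineq2[of w z] assms by simp
  have "poisson z w \<le> (1 - (norm z)\<^sup>2) / (1 - norm z)\<^sup>2"
    unfolding poisson_def
    by (intro divide_left_mono power_mono mult_pos_pos zero_less_power) (use a assms in \<open>auto simp: power_le_one intro: less_le_trans[OF _ a]\<close>)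
  also have "\<dots> = (1 + norm z) / (1 - norm z)"
  proof -
    have "1 - (norm z)\<^sup>2 = (1 - norm z) * (1 + norm z)"
      by (simp add: power2_eq_square algebra_simps)
    then show ?thesis using assms by (simp add: power2_eq_square)
  qed
  also have "\<dots> \<le> 2 / (1 - norm z)"
    using assms by (intro divide_right_mono) auto
  finally show ?thesis .
qed

text \<open>On the circle \<open>cnj w\<close> inverts \<open>w\<close>, hence
  \<open>1 - cnj z * w = w * cnj (w - z)\<close>. This trades the squared modulus for a factor
  holomorphic in \<open>w\<close> times Cauchy's kernel.\<close>

lemma poisson_eq_cauchy_kernel:
  assumes "norm w = 1" "norm z < 1"
  shows "complex_of_real (poisson z w) = (1 - of_real ((norm z)\<^sup>2)) / (1 - cnj z * w) * w / (w - z)"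
    and "1 - cnj z * w \<noteq> 0"
proof -
  have ww: "w * cnj w = 1" using assms by (simp add: complex_norm_square[symmetric])
  have wz: "w \<noteq> z" "w \<noteq> 0" using assms by auto
  have e: "1 - cnj z * w = w * cnj (w - z)" using ww by (simp add: algebra_simps)
  have "complex_of_real (poisson z w) = (1 - of_real ((norm z)\<^sup>2)) / ((w - z) * cnj (w - z))"
    unfolding poisson_def by (simp only: of_real_divide of_real_diff of_real_1 complex_norm_square)
  then show "complex_of_real (poisson z w) = (1 - of_real ((norm z)\<^sup>2)) / (1 - cnj z * w) * w / (w - z)"
    unfolding e using wz by (simp del: complex_cnj_diff add: mult.commute)
  show "1 - cnj z * w \<noteq> 0" unfolding e using wz by simp
qed

lemma poisson_integral_closed_disc:
  assumes F: "continuous_on (cball 0 1) F" "F holomorphic_on ball 0 1" and z: "norm z < 1"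
  shows "(\<integral>w. F w * of_real (poisson z w) \<partial>circle_measure) = F z"
proof -
  \<comment> \<open>The extra factor can have a pole only at \<open>1 / cnj z\<close>, outside the
    closed disc, and it equals \<open>1\<close> at \<open>z\<close>. So Cauchy's formula for
    \<open>G\<close> still returns \<open>F z\<close>.\<close>
  define G where "G w = F w * (1 - of_real ((norm z)\<^sup>2)) / (1 - cnj z * w)" for w
  have nz: "1 - cnj z * w \<noteq> 0" if "norm w \<le> 1" for w
  proof
    assume "1 - cnj z * w = 0"
    then have "norm (cnj z * w) = 1" by simp
    moreover have "norm (cnj z * w) \<le> norm z * 1"
      unfolding norm_mult using that by (intro mult_mono) auto
    ultimately show False using z by simp
  qed
  have "(\<integral>w. G w * w / (w - z) \<partial>circle_measure) = G z"
  proof (rule cauchy_circle[OF _ _ z])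
    show "continuous_on (cball 0 1) G"
      unfolding G_def by (intro continuous_intros F) (use nz in auto)
    show "G holomorphic_on ball 0 1"
      unfolding G_def by (intro holomorphic_intros F) (use nz in auto)
  qed
  moreover have "(\<integral>w. G w * w / (w - z) \<partial>circle_measure) = (\<integral>w. F w * of_real (poisson z w) \<partial>circle_measure)"
    by (rule Bochner_Integration.integral_cong) (use z in \<open>auto simp: G_def poisson_eq_cauchy_kernel\<close>)
  moreover have "G z = F z"
    using nz[of z] z unfolding G_def
    by (simp add: complex_norm_square mult.commute del: of_real_power)
  ultimately show ?thesis by simp
qed

lemma integral_poisson:
  assumes "norm z < 1"
  shows "(\<integral>w. poisson z w \<partial>circle_measure) = 1"
proof -
  have "(\<integral>w. complex_of_real (poisson z w) \<partial>circle_measure) = 1"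
    using poisson_integral_closed_disc[of "\<lambda>_. 1" z] assms by simp
  then show ?thesis by (simp del: of_real_eq_1_iff add: of_real_eq_1_iff[symmetric, where 'a=complex])
qed

text \<open>Dominated convergence and measurability of limits want a sequence, whereas radial limits
  run along \<open>at_left 1\<close>; this is one fixed sequence of radii. The shift by
  \<open>2\<close> keeps \<open>rad 0\<close> positive.\<close>

definition rad :: "nat \<Rightarrow> real" where "rad n = 1 - 1 / real (n + 2)"

lemma rad_bounds: "0 < rad n" "rad n < 1"
  by (auto simp: rad_def)

lemma rad_tendsto: "filterlim rad (at_left 1) sequentially"
proof -
  have "rad \<longlonglongrightarrow> 1" unfolding rad_def by real_asymp
  then show ?thesis
    using rad_bounds(2) by (auto simp: filterlim_at less_imp_neq)
qed

lemma norm_dilate: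
  fixes w :: complex
  assumes "0 < s" "s < 1" "norm w \<le> 1"
  shows "norm (of_real s * w) < 1"
proof -
  have "norm (of_real s * w) \<le> s * 1"
    unfolding norm_mult using assms by (intro mult_mono) auto
  then show ?thesis using assms by simp
qed

lemma holomorphic_dilate:
  assumes "F holomorphic_on ball 0 1" "0 < s" "s < 1"
  shows "(\<lambda>w. F (of_real s * w)) holomorphic_on ball 0 1"
  by (rule holomorphic_on_compose_gen[unfolded o_def, of _ _ F "ball 0 1"])
     (use norm_dilate[OF assms(2,3)] assms in \<open>auto intro!: holomorphic_intros simp del: norm_mult\<close>)

lemma continuous_on_dilate:
  assumes "F holomorphic_on ball 0 1" "0 < s" "s < 1"
  shows "continuous_on (cball 0 1) (\<lambda>w. F (of_real s * w))"
  by (rule continuous_on_compose2[OF holomorphic_on_imp_continuous_on[OF assms(1)]])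
     (use norm_dilate[OF assms(2,3)] in \<open>auto intro!: continuous_intros simp del: norm_mult\<close>)

lemma measurable_dilate:
  assumes "F holomorphic_on ball 0 1" "0 < s" "s < 1"
  shows "(\<lambda>w. F (of_real s * w)) \<in> borel_measurable circle_measure"
  by (rule borel_measurable_circle_continuous) (rule continuous_on_subset[OF continuous_on_dilate[OF assms]], auto)

lemma rad_tendsto_1: "rad \<longlonglongrightarrow> 1"
  using rad_tendsto by (simp add: filterlim_at)

lemma tendsto_dilate:
  assumes "F holomorphic_on ball 0 1" "norm z < 1"
  shows "(\<lambda>n. F (of_real (rad n) * z)) \<longlonglongrightarrow> F z"
proof -
  have "isCont F z"
    using assms by (intro continuous_on_interior[OF holomorphic_on_imp_continuous_on]) (auto simp: interior_open)
  moreover have "(\<lambda>n. of_real (rad n) * z) \<longlonglongrightarrow> of_real 1 * z"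
    by (intro tendsto_intros rad_tendsto_1)
  ultimately show ?thesis by (intro isCont_tendsto_compose[of _ F]) auto
qed

lemma radial_limit_rad:
  "has_radial_limit F w v \<Longrightarrow> (\<lambda>n. F (of_real (rad n) * w)) \<longlonglongrightarrow> v"
  unfolding has_radial_limit_def
  by (erule filterlim_compose[of "\<lambda>r. F (complex_of_real r * w)"]) (rule rad_tendsto)

text \<open>The dilates of \<open>F\<close> are continuous up to the circle, where the formula is
  already known; boundedness of \<open>F\<close> lets dominated convergence carry it to radius
  one.\<close>

lemma poisson_integral_radial_limit:
  assumes F: "F holomorphic_on ball 0 1" "\<And>w. norm w < 1 \<Longrightarrow> norm (F w) \<le> C"
    and \<phi>: "\<phi> \<in> borel_measurable circle_measure" "AE w in circle_measure. has_radial_limit F w (\<phi> w)"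
    and z: "norm z < 1"
  shows "(\<integral>w. \<phi> w * of_real (poisson z w) \<partial>circle_measure) = F z"
proof -
  let ?G = "\<lambda>n w. F (of_real (rad n) * w)"
  have "(\<lambda>n. \<integral>w. ?G n w * of_real (poisson z w) \<partial>circle_measure) \<longlonglongrightarrow>
      (\<integral>w. \<phi> w * of_real (poisson z w) \<partial>circle_measure)"
  proof (rule integral_dominated_convergence[where w="\<lambda>_. C * (2 / (1 - norm z))"])
    show "AE w in circle_measure. (\<lambda>n. ?G n w * of_real (poisson z w)) \<longlonglongrightarrow> \<phi> w * of_real (poisson z w)"
      using \<phi>(2)
    proof eventually_elim
      fix w assume "has_radial_limit F w (\<phi> w)"
      then have "(\<lambda>n. ?G n w) \<longlonglongrightarrow> \<phi> w" by (rule radial_limit_rad)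
      then show "(\<lambda>n. ?G n w * of_real (poisson z w)) \<longlonglongrightarrow> \<phi> w * of_real (poisson z w)"
        by (intro tendsto_intros)
    qed
    show "AE w in circle_measure. norm (?G n w * of_real (poisson z w)) \<le> C * (2 / (1 - norm z))" for n
    proof (rule AE_I2)
      fix w assume "w \<in> space circle_measure"
      then have w: "norm w = 1" by simp
      have "norm (?G n w) \<le> C" using F(2) w rad_bounds[of n] by (simp add: norm_mult)
      then show "norm (?G n w * of_real (poisson z w)) \<le> C * (2 / (1 - norm z))"
        unfolding norm_mult using poisson_le[OF w z] poisson_nonneg[of z w] z
        by (intro mult_mono) (auto intro: order_trans[OF norm_ge_zero])
    qed
  qed (use \<phi>(1) measurable_dilate[OF F(1) rad_bounds] in measurable)
  moreover have "(\<integral>w. ?G n w * of_real (poisson z w) \<partial>circle_measure) = F (of_real (rad n) * z)" for n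
    by (rule poisson_integral_closed_disc[OF continuous_on_dilate[OF F(1) rad_bounds] holomorphic_dilate[OF F(1) rad_bounds] z])
  ultimately show ?thesis using LIMSEQ_unique[OF _ tendsto_dilate[OF F(1) z]] by simp
qed

section \<open>Density points\<close>

text \<open>Measured against the radius, which is comparable to the length of the arc cut out by a
  small disc. Discs of the plane are used because the Poisson kernel depends on chordal
  distance.\<close>

definition zero_density_at :: "complex set \<Rightarrow> complex \<Rightarrow> bool" where
  "zero_density_at E \<zeta> \<longleftrightarrow> (\<forall>\<epsilon>>0. \<exists>\<delta>>0. \<forall>\<rho>. 0 < \<rho> \<and> \<rho> \<le> \<delta> \<longrightarrow> measure circle_measure (E \<inter> cball \<zeta> \<rho>) \<le> \<epsilon> * \<rho>)"

text \<open>Cover the complement of \<open>A\<close> by an open set \<open>U\<close> that meets \<open>A\<close> in small measure.  Vitali's theorem yields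
  disjoint intervals inside \<open>U\<close> that cover \<open>S\<close> up to a null set, each with a fixed proportion in \<open>A\<close>.\<close>

lemma density_covering:
  fixes A :: "real set"
  assumes A: "A \<in> sets lebesgue" and c: "c > 0"
    and S: "\<And>t. t \<in> S \<Longrightarrow> t \<notin> A \<and> (\<forall>\<delta>>0. \<exists>\<rho>. 0 < \<rho> \<and> \<rho> \<le> \<delta> \<and> measure lebesgue (A \<inter> cball t \<rho>) > c * \<rho>)"
  shows "negligible S"
proof (rule negligible_outer_le[THEN iffD2], intro allI impI)
  fix e :: real assume e: "e > 0"
  \<comment> \<open>A selected interval has length \<open>2 * \<rho>\<close> and more than
    \<open>c * \<rho>\<close> of it lies in \<open>A\<close>, so lengths exceed shares by a factor
    of at most \<open>2 / c\<close>. The bound \<open>c * e / 2\<close> on all the shares together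
    then yields \<open>e\<close>.\<close>
  obtain U where U: "open U" "- A \<subseteq> U" "U - (- A) \<in> lmeasurable" "emeasure lebesgue (U - (- A)) < ennreal (c * e / 2)"
    using sets_lebesgue_outer_open[of "- A" "c * e / 2"] A c e by (auto simp: Compl_in_sets_lebesgue)
  define K where "K = {(t, \<rho>). t \<in> S \<and> 0 < \<rho> \<and> cball t \<rho> \<subseteq> U \<and> measure lebesgue (A \<inter> cball t \<rho>) > c * \<rho>}"
  have "\<exists>i. i \<in> K \<and> x \<in> cball (fst i) (snd i) \<and> snd i < d" if x: "x \<in> S" and d: "0 < d" for x d
  proof -
    obtain d' where d': "d' > 0" "cball x d' \<subseteq> U"
      using U(1,2) S[OF x] open_contains_cball by blast
    obtain \<rho> where \<rho>: "0 < \<rho>" "\<rho> \<le> min d' (d/2)" "measure lebesgue (A \<inter> cball x \<rho>) > c * \<rho>"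
      using S[OF x] d d' by (meson half_gt_zero min_less_iff_conj)
    have "cball x \<rho> \<subseteq> cball x d'" by (rule subset_cball) (use \<rho> in auto)
    with \<rho> x d' d have "(x, \<rho>) \<in> K" unfolding K_def by auto
    then show ?thesis using \<rho> d by (intro exI[of _ "(x, \<rho>)"]) auto
  qed
  then obtain C where C: "countable C" "C \<subseteq> K"
     "pairwise (\<lambda>i j. disjnt (cball (fst i) (snd i)) (cball (fst j) (snd j))) C"
     "negligible (S - (\<Union>i\<in>C. cball (fst i) (snd i)))"
    using Vitali_covering_theorem_cballs[of K snd S fst] unfolding K_def by force
  let ?B = "\<lambda>i. cball (fst i) (snd i)"
  have disj: "disjoint_family_on ?B C"
    using C(3) by (auto simp: pairwise_def disjoint_family_on_def disjnt_def)
  have "emeasure lebesgue (\<Union>i\<in>C. ?B i) = (\<integral>\<^sup>+i. emeasure lebesgue (?B i) \<partial>count_space C)"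
    by (rule emeasure_UN_countable) (use C(1) disj in auto)
  also have "\<dots> \<le> (\<integral>\<^sup>+i. ennreal (2/c) * emeasure lebesgue (A \<inter> ?B i) \<partial>count_space C)"
  proof (rule nn_integral_mono)
    fix i assume "i \<in> space (count_space C)"
    then have i: "i \<in> K" using C by auto
    have s: "snd i > 0" using i by (auto simp: K_def)
    have lm: "A \<inter> ?B i \<in> lmeasurable"
      by (metis A fmeasurable_Int_fmeasurable lmeasurable_cball inf_commute)
    have "emeasure lebesgue (?B i) = ennreal (2 * snd i)"
      using s by (simp add: cball_eq_atLeastAtMost)
    also have "\<dots> \<le> ennreal (2/c * measure lebesgue (A \<inter> ?B i))"
      using i c by (intro ennreal_leI) (auto simp: K_def field_simps)
    also have "\<dots> = ennreal (2/c) * emeasure lebesgue (A \<inter> ?B i)"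
      using c lm by (subst ennreal_mult) (auto simp: emeasure_eq_measure2)
    finally show "emeasure lebesgue (?B i) \<le> ennreal (2/c) * emeasure lebesgue (A \<inter> ?B i)" .
  qed
  also have "\<dots> = ennreal (2/c) * (\<integral>\<^sup>+i. emeasure lebesgue (A \<inter> ?B i) \<partial>count_space C)"
    by (rule nn_integral_cmult) auto
  finally have le1: "emeasure lebesgue (\<Union>i\<in>C. ?B i) \<le> ennreal (2/c) * (\<integral>\<^sup>+i. emeasure lebesgue (A \<inter> ?B i) \<partial>count_space C)" .
  have "(\<integral>\<^sup>+i. emeasure lebesgue (A \<inter> ?B i) \<partial>count_space C) = emeasure lebesgue (\<Union>i\<in>C. A \<inter> ?B i)"
    by (rule emeasure_UN_countable[symmetric])
       (use C(1) A disj in \<open>fastforce simp: disjoint_family_on_def\<close>)+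
  also have "\<dots> \<le> emeasure lebesgue (U - (- A))"
  proof (rule emeasure_mono)
    show "(\<Union>i\<in>C. A \<inter> ?B i) \<subseteq> U - - A"
    proof
      fix x assume "x \<in> (\<Union>i\<in>C. A \<inter> ?B i)"
      then obtain t \<rho> where "(t, \<rho>) \<in> C" "x \<in> cball t \<rho>" "x \<in> A" by auto
      then show "x \<in> U - - A" using C(2) unfolding K_def by blast
    qed
  qed (use U(3) in auto)
  also have "\<dots> \<le> ennreal (c * e / 2)" using U(4) by simp
  finally have le2: "(\<integral>\<^sup>+i. emeasure lebesgue (A \<inter> ?B i) \<partial>count_space C) \<le> ennreal (c * e / 2)" .
  have "emeasure lebesgue (\<Union>i\<in>C. ?B i) \<le> ennreal (2/c) * ennreal (c * e / 2)"
    by (rule order_trans[OF le1 mult_left_mono[OF le2]]) simp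
  also have "\<dots> = ennreal e" using c e by (simp add: ennreal_mult[symmetric])
  finally have em: "emeasure lebesgue (\<Union>i\<in>C. ?B i) \<le> ennreal e" .
  have m1: "(\<Union>i\<in>C. ?B i) \<in> lmeasurable"
    by (rule fmeasurableI) (use C(1) em in \<open>auto intro: order.strict_trans1\<close>)
  show "\<exists>T. S \<subseteq> T \<and> T \<in> lmeasurable \<and> measure lebesgue T \<le> e"
  proof (intro exI conjI)
    show "S \<subseteq> (S - (\<Union>i\<in>C. ?B i)) \<union> (\<Union>i\<in>C. ?B i)" by blast
    show "(S - (\<Union>i\<in>C. ?B i)) \<union> (\<Union>i\<in>C. ?B i) \<in> lmeasurable"
      using m1 C(4) by (meson fmeasurable.Un negligible_imp_measurable)
    have "measure lebesgue ((S - (\<Union>i\<in>C. ?B i)) \<union> (\<Union>i\<in>C. ?B i)) \<le> 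
        measure lebesgue (S - (\<Union>i\<in>C. ?B i)) + measure lebesgue (\<Union>i\<in>C. ?B i)"
      by (rule measure_Un_le) (use m1 C(4) negligible_imp_measurable in \<open>auto\<close>)
    also have "\<dots> \<le> e"
      using em e m1 negligible_imp_measure0[OF C(4)] by (simp add: emeasure_eq_measure2)
    finally show "measure lebesgue ((S - (\<Union>i\<in>C. ?B i)) \<union> (\<Union>i\<in>C. ?B i)) \<le> e" .
  qed
qed

text \<open>A failure for some \<open>\<epsilon>\<close> is already a failure for some
  \<open>1 / real (Suc n)\<close>, so countably many applications of \<open>density_covering\<close>
  suffice.\<close>

lemma density_negligible:
  fixes A :: "real set"
  assumes A: "A \<in> sets lebesgue"
  shows "negligible {t. t \<notin> A \<and> \<not> (\<forall>\<epsilon>>0. \<exists>\<delta>>0. \<forall>\<rho>. 0 < \<rho> \<and> \<rho> \<le> \<delta> \<longrightarrow> measure lebesgue (A \<inter> cball t \<rho>) \<le> \<epsilon> * \<rho>)}"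
proof -
  define S where "S n = {t. t \<notin> A \<and> (\<forall>\<delta>>0. \<exists>\<rho>. 0 < \<rho> \<and> \<rho> \<le> \<delta> \<and> measure lebesgue (A \<inter> cball t \<rho>) > (1 / real (Suc n)) * \<rho>)}" for n
  have "negligible (S n)" for n
    by (rule density_covering[OF A, of "1 / real (Suc n)"]) (auto simp: S_def)
  then have "negligible (\<Union>n. S n)" by (intro negligible_countable_Union) auto
  then show ?thesis
  proof (rule negligible_subset, intro subsetI)
    fix t assume "t \<in> {t. t \<notin> A \<and> \<not> (\<forall>\<epsilon>>0. \<exists>\<delta>>0. \<forall>\<rho>. 0 < \<rho> \<and> \<rho> \<le> \<delta> \<longrightarrow> measure lebesgue (A \<inter> cball t \<rho>) \<le> \<epsilon> * \<rho>)}"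
    then obtain \<epsilon> where t: "t \<notin> A" and \<epsilon>: "0 < \<epsilon>"
      and neg: "\<not> (\<exists>\<delta>>0. \<forall>\<rho>. 0 < \<rho> \<and> \<rho> \<le> \<delta> \<longrightarrow> measure lebesgue (A \<inter> cball t \<rho>) \<le> \<epsilon> * \<rho>)"
      by blast
    obtain n where n: "1 / real (Suc n) < \<epsilon>" using \<epsilon> nat_approx_posE by blast
    have "\<exists>\<rho>. 0 < \<rho> \<and> \<rho> \<le> \<delta> \<and> measure lebesgue (A \<inter> cball t \<rho>) > (1 / real (Suc n)) * \<rho>" if \<delta>: "\<delta> > 0" for \<delta>
    proof -
      obtain \<rho> where \<rho>: "0 < \<rho>" "\<rho> \<le> \<delta>" "measure lebesgue (A \<inter> cball t \<rho>) > \<epsilon> * \<rho>"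
        using neg \<delta> not_le by blast
      moreover have "(1 / real (Suc n)) * \<rho> \<le> \<epsilon> * \<rho>" using n \<rho> by (intro mult_right_mono) auto
      ultimately show ?thesis by (intro exI[of _ \<rho>]) linarith
    qed
    then show "t \<in> (\<Union>n. S n)" using t unfolding S_def by blast
  qed
qed

text \<open>A negligible set of angles need not be Borel. It is enlarged to a Borel null set and
  moved to the circle as a preimage under \<open>Arg2pi\<close>, which is continuous off the
  nonnegative real axis. This is why the angle \<open>0\<close> is left out.\<close>

lemma AE_cis_negligible:
  assumes N: "negligible N" and P: "\<And>t. \<lbrakk>0 < t; t < 2 * pi; t \<notin> N\<rbrakk> \<Longrightarrow> P (cis t)"
  shows "AE \<zeta> in circle_measure. P \<zeta>"
proof -
  obtain N' where N': "N' \<in> null_sets lborel" "N \<subseteq> N'"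
    using N unfolding negligible_iff_null_sets null_sets_completion_iff2 by blast
  define G where "G = Arg2pi -` (- N') \<inter> (UNIV - \<real>\<^sub>\<ge>\<^sub>0)"
  have op: "open (UNIV - (\<real>\<^sub>\<ge>\<^sub>0 :: complex set))" by (intro open_Diff) auto
  have "continuous_on (UNIV - \<real>\<^sub>\<ge>\<^sub>0) Arg2pi"
    using continuous_at_Arg2pi continuous_at_imp_continuous_on by blast
  then have "Arg2pi \<in> borel_measurable (restrict_space borel (UNIV - \<real>\<^sub>\<ge>\<^sub>0))"
    by (rule borel_measurable_continuous_on_restrict)
  from measurable_sets[OF this, of "- N'"] N' have "G \<in> sets (restrict_space borel (UNIV - \<real>\<^sub>\<ge>\<^sub>0))"
    by (auto simp: G_def space_restrict_space null_sets_def)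
  then have G: "G \<in> sets borel"
    by (subst (asm) sets_restrict_space_iff) (use op in auto)
  have "AE \<zeta> in circle_measure. \<zeta> \<in> G"
  proof (rule AE_cisI[OF G])
    show "AE t in lborel. t \<in> {0..<2*pi} \<longrightarrow> cis t \<in> G"
      using AE_not_in[OF N'(1)] AE_lborel_singleton[of "0::real"]
    proof eventually_elim
      fix t :: real assume t: "t \<notin> N'" "t \<noteq> 0"
      show "t \<in> {0..<2*pi} \<longrightarrow> cis t \<in> G"
      proof
        assume t2: "t \<in> {0..<2*pi}"
        have a: "Arg2pi (cis t) = t"
          by (rule Arg2pi_unique[of 1]) (use t2 in \<open>auto simp: cis_conv_exp\<close>)
        have "cis t \<notin> \<real>\<^sub>\<ge>\<^sub>0"
          using a t Arg2pi_eq_0[of "cis t"] by (auto simp: complex_nonneg_Reals_iff complex_is_Real_iff)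
        then show "cis t \<in> G" using a t by (simp add: G_def)
      qed
    qed
  qed
  then have ae: "AE \<zeta> in circle_measure. \<zeta> \<in> G \<and> \<zeta> \<in> space circle_measure"
    by (intro AE_conjI AE_space)
  show ?thesis using ae
  proof eventually_elim
    fix \<zeta> assume z: "\<zeta> \<in> G \<and> \<zeta> \<in> space circle_measure"
    then have eq: "\<zeta> = cis (Arg2pi \<zeta>)"
      using Arg2pi_eq[of \<zeta>] by (simp add: cis_conv_exp)
    have "Arg2pi \<zeta> \<noteq> 0"
      using z Arg2pi_eq_0[of \<zeta>] by (auto simp: G_def complex_nonneg_Reals_iff complex_is_Real_iff)
    then have "0 < Arg2pi \<zeta>" "Arg2pi \<zeta> < 2 * pi" using Arg2pi[of \<zeta>] by auto
    moreover have "Arg2pi \<zeta> \<notin> N" using z N' by (auto simp: G_def)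
    ultimately show "P \<zeta>" using P eq by metis
  qed
qed

text \<open>The chord between two angles has length
  \<open>2 * \<bar>sin ((u - t) / 2)\<bar>\<close>. Writing it with \<open>sinc\<close> splits off
  the difference of the angles and leaves a factor that is continuous also at
  \<open>u = t\<close>.\<close>

lemma norm_cis_diff: "norm (cis u - cis t) = \<bar>u - t\<bar> * \<bar>sinc ((u - t) / 2)\<bar>"
proof -
  have "(norm (cis u - cis t))\<^sup>2 = (cos u - cos t)\<^sup>2 + (sin u - sin t)\<^sup>2"
    by (simp add: cmod_power2)
  also have "\<dots> = (sin u)\<^sup>2 + (cos u)\<^sup>2 + ((sin t)\<^sup>2 + (cos t)\<^sup>2) - 2 * cos (u - t)"
    unfolding cos_diff by (simp add: power2_eq_square algebra_simps)
  also have "\<dots> = 2 - 2 * cos (2 * ((u - t) / 2))"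
    by (simp only: sin_cos_squared_add times_divide_eq_right nonzero_mult_div_cancel_left)
  also have "\<dots> = (2 * sin ((u - t) / 2))\<^sup>2"
    by (simp only: cos_double_sin) (simp only: power2_eq_square, algebra)
  also have "\<dots> = \<bar>2 * sin ((u - t) / 2)\<bar>\<^sup>2"
    by (rule power2_abs[symmetric])
  finally have "norm (cis u - cis t) = \<bar>2 * sin ((u - t) / 2)\<bar>"
    by (rule power2_eq_imp_eq) (rule norm_ge_zero abs_ge_zero)+
  then show ?thesis by (auto simp: abs_mult)
qed

text \<open>Compactness: the continuous factor \<open>sinc\<close> attains its minimal modulus,
  which is not zero because \<open>(u - t) / 2\<close> stays strictly between \<open>-pi\<close> and
  \<open>pi\<close>. For \<open>t = 0\<close> this would fail at \<open>u = 2 * pi\<close>, the same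
  point of the circle.\<close>

lemma cis_diff_ge:
  assumes t: "0 < t" "t < 2 * pi"
  obtains c where "c > 0" "\<And>u. u \<in> {0..2*pi} \<Longrightarrow> c * \<bar>u - t\<bar> \<le> norm (cis u - cis t)"
proof -
  have "continuous_on {0..2*pi} (\<lambda>u. \<bar>sinc ((u - t) / 2)\<bar>)"
    by (intro continuous_intros continuous_on_compose2[OF continuous_on_sinc[where S=UNIV]]) (auto intro!: continuous_intros)
  then obtain u0 where u0: "u0 \<in> {0..2*pi}" "\<And>u. u \<in> {0..2*pi} \<Longrightarrow> \<bar>sinc ((u0 - t) / 2)\<bar> \<le> \<bar>sinc ((u - t) / 2)\<bar>"
    using continuous_attains_inf[of "{0..2*pi}" "\<lambda>u. \<bar>sinc ((u - t) / 2)\<bar>"] by auto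
  have "sinc ((u0 - t) / 2) \<noteq> 0"
  proof
    assume 0: "sinc ((u0 - t) / 2) = 0"
    then have ne: "u0 \<noteq> t" and s: "sin ((u0 - t) / 2) = 0" by (auto split: if_splits)
    have "\<bar>(u0 - t) / 2\<bar> < pi" using u0 t by auto
    then show False using s ne sin_zero_pi_iff[of "(u0 - t) / 2"] by auto
  qed
  then show thesis
    using that[of "\<bar>sinc ((u0 - t) / 2)\<bar>"] u0 by (simp add: norm_cis_diff mult.commute mult_left_mono)
qed

lemma measure_circle_borel:
  assumes E: "E \<in> sets borel"
  shows "measure circle_measure (E \<inter> sphere 0 1) = measure lborel ({0..2*pi} \<inter> cis -` E) / (2 * pi)"
proof -
  have Es: "E \<inter> sphere 0 1 \<in> sets circle_measure"
    unfolding circle_measure_eq using circle_set_borel[OF E] by auto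
  have "measure circle_measure (E \<inter> sphere 0 1) = (\<integral>x. indicator (E \<inter> sphere 0 1) x \<partial>circle_measure)"
    using Es by simp
  also have "\<dots> = (LINT t:{0..2*pi}|lborel. indicator (E \<inter> sphere 0 1) (cis t)) /\<^sub>R (2*pi)"
    by (rule integral_circle_measure) (use E in \<open>auto intro!: borel_measurable_indicator simp: sets_restrict_space\<close>)
  also have "(LINT t:{0..2*pi}|lborel. indicator (E \<inter> sphere 0 1) (cis t)) = (\<integral>t. indicator ({0..2*pi} \<inter> cis -` E) t \<partial>lborel :: real)"
    unfolding set_lebesgue_integral_def
    by (rule Bochner_Integration.integral_cong) (auto split: split_indicator)
  also have "\<dots> = measure lborel ({0..2*pi} \<inter> cis -` E)" by simp
  finally show ?thesis by (simp only: real_scaleR_def divide_inverse_commute)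
qed

text \<open>By \<open>cis_diff_ge\<close>, a disc of radius \<open>\<rho>\<close> around
  \<open>cis t\<close> contains only points of angle within \<open>\<rho> / c\<close> of
  \<open>t\<close>. So zero density of the set of angles at \<open>t\<close> passes to the circle
  once \<open>\<epsilon>\<close> and \<open>\<delta>\<close> are rescaled by
  \<open>c\<close>.\<close>

lemma AE_zero_density:
  assumes E: "E \<in> sets borel" "E \<subseteq> sphere 0 1"
  shows "AE \<zeta> in circle_measure. \<zeta> \<notin> E \<longrightarrow> zero_density_at E \<zeta>"
proof -
  define A where "A = {0..2*pi} \<inter> cis -` E"
  have [measurable]: "cis -` E \<in> sets borel" using measurable_sets[OF cis_borel E(1)] by simp
  have Ab: "A \<in> sets borel" unfolding A_def by measurable
  then have Al: "A \<in> sets lebesgue" by simp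
  show ?thesis
  proof (rule AE_cis_negligible[OF density_negligible[OF Al]], intro impI)
    fix t assume t: "0 < t" "t < 2 * pi" and tE: "cis t \<notin> E"
      and tn: "t \<notin> {t. t \<notin> A \<and> \<not> (\<forall>\<epsilon>>0. \<exists>\<delta>>0. \<forall>\<rho>. 0 < \<rho> \<and> \<rho> \<le> \<delta> \<longrightarrow> measure lebesgue (A \<inter> cball t \<rho>) \<le> \<epsilon> * \<rho>)}"
    have "t \<notin> A" using tE by (simp add: A_def)
    with tn have dens: "\<exists>\<delta>>0. \<forall>\<rho>. 0 < \<rho> \<and> \<rho> \<le> \<delta> \<longrightarrow> measure lebesgue (A \<inter> cball t \<rho>) \<le> \<epsilon> * \<rho>" if "\<epsilon> > 0" for \<epsilon>
      using that by blast
    obtain c where c: "c > 0" "\<And>u. u \<in> {0..2*pi} \<Longrightarrow> c * \<bar>u - t\<bar> \<le> norm (cis u - cis t)"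
      using cis_diff_ge[OF t] by blast
    show "zero_density_at E (cis t)"
      unfolding zero_density_at_def
    proof (intro allI impI)
      fix \<epsilon> :: real assume \<epsilon>: "\<epsilon> > 0"
      obtain \<delta> where \<delta>: "\<delta> > 0" "\<And>\<rho>. 0 < \<rho> \<Longrightarrow> \<rho> \<le> \<delta> \<Longrightarrow> measure lebesgue (A \<inter> cball t \<rho>) \<le> \<epsilon> * c * \<rho>"
        using dens[of "\<epsilon> * c"] \<epsilon> c by auto
      show "\<exists>\<delta>>0. \<forall>\<rho>. 0 < \<rho> \<and> \<rho> \<le> \<delta> \<longrightarrow> measure circle_measure (E \<inter> cball (cis t) \<rho>) \<le> \<epsilon> * \<rho>"
      proof (intro exI[of _ "c * \<delta>"] conjI allI impI)
        show "0 < c * \<delta>" using c \<delta> by simp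
        fix \<rho> assume \<rho>: "0 < \<rho> \<and> \<rho> \<le> c * \<delta>"
        have B: "A \<inter> cball t (\<rho>/c) \<in> sets borel" using Ab by auto
        have "{0..2*pi} \<inter> cis -` (E \<inter> cball (cis t) \<rho>) \<subseteq> A \<inter> cball t (\<rho>/c)"
        proof
          fix u assume u: "u \<in> {0..2*pi} \<inter> cis -` (E \<inter> cball (cis t) \<rho>)"
          then have "c * \<bar>u - t\<bar> \<le> \<rho>" using c(2)[of u] by (auto simp: dist_norm norm_minus_commute)
          then show "u \<in> A \<inter> cball t (\<rho>/c)" using u c(1) by (auto simp: A_def dist_real_def field_simps abs_minus_commute)
        qed
        then have "measure lborel ({0..2*pi} \<inter> cis -` (E \<inter> cball (cis t) \<rho>)) \<le> measure lborel (A \<inter> cball t (\<rho>/c))"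
        proof (rule measure_mono_fmeasurable)
          have "cis -` (E \<inter> cball (cis t) \<rho>) \<in> sets borel"
            using measurable_sets[OF cis_borel, of "E \<inter> cball (cis t) \<rho>"] E(1) by simp
          then show "{0..2*pi} \<inter> cis -` (E \<inter> cball (cis t) \<rho>) \<in> sets lborel" by auto
          show "A \<inter> cball t (\<rho>/c) \<in> fmeasurable lborel"
            by (rule fmeasurable_Int_fmeasurable[of "cball t (\<rho>/c)" _ A, simplified inf_commute]) (use Ab in \<open>auto intro!: fmeasurable_compact\<close>)
        qed
        also have "\<dots> = measure lebesgue (A \<inter> cball t (\<rho>/c))" using B by simp
        also have "\<dots> \<le> \<epsilon> * c * (\<rho>/c)"
          using \<rho> c(1) by (intro \<delta>(2)) (auto simp: field_simps)
        also have "\<dots> = \<epsilon> * \<rho>" using c by simp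
        finally have le: "measure lborel ({0..2*pi} \<inter> cis -` (E \<inter> cball (cis t) \<rho>)) \<le> \<epsilon> * \<rho>" .
        have eq: "E \<inter> cball (cis t) \<rho> = (E \<inter> cball (cis t) \<rho>) \<inter> sphere 0 1" using E(2) by auto
        have "measure circle_measure (E \<inter> cball (cis t) \<rho>) = measure lborel ({0..2*pi} \<inter> cis -` (E \<inter> cball (cis t) \<rho>)) / (2*pi)"
          by (subst eq, rule measure_circle_borel) (use E in auto)
        also have "\<dots> \<le> measure lborel ({0..2*pi} \<inter> cis -` (E \<inter> cball (cis t) \<rho>)) / 1"
          using pi_gt3 by (intro divide_left_mono) auto
        finally show "measure circle_measure (E \<inter> cball (cis t) \<rho>) \<le> \<epsilon> * \<rho>" using le by simp
      qed
    qed
  qed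
qed

section \<open>Fatou's theorem for bounded functions\<close>

interpretation circle_complete: complete_measure circle_measure
  unfolding circle_measure_eq by (rule completion.complete_measure_axioms)

text \<open>A set of the completion sits inside a Borel set \<open>F\<close> that exceeds it by a
  null set at most. Off that null set, zero density of \<open>F\<close> is available, and it is
  inherited by subsets.\<close>

lemma AE_zero_density_complete:
  assumes "E \<in> sets circle_measure"
  shows "AE \<zeta> in circle_measure. \<zeta> \<notin> E \<longrightarrow> zero_density_at E \<zeta>"
proof -
  obtain S N N' where E: "E = S \<union> N" "N \<subseteq> N'" "N' \<in> null_sets circle_base" "S \<in> sets circle_base"
    using assms unfolding circle_measure_eq by (rule sets_completionE)
  define F where "F = S \<union> N'"
  have Fs: "F \<in> sets circle_base" using E by (auto simp: F_def)
  then have F: "F \<in> sets borel" "F \<subseteq> sphere 0 1"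
    unfolding sets_circle_base by (auto simp: sets_restrict_space_iff)
  have EF: "E \<subseteq> F" using E by (auto simp: F_def)
  have "AE \<zeta> in circle_measure. \<zeta> \<notin> N'"
    unfolding circle_measure_eq using AE_not_in[OF E(3)] by (rule AE_completion)
  then show ?thesis using AE_zero_density[OF F]
  proof eventually_elim
    fix \<zeta> assume a: "\<zeta> \<notin> N'" "\<zeta> \<notin> F \<longrightarrow> zero_density_at F \<zeta>"
    show "\<zeta> \<notin> E \<longrightarrow> zero_density_at E \<zeta>"
    proof
      assume "\<zeta> \<notin> E"
      then have t: "zero_density_at F \<zeta>" using a E(1) by (auto simp: F_def)
      have "measure circle_measure (E \<inter> cball \<zeta> \<rho>) \<le> measure circle_measure (F \<inter> cball \<zeta> \<rho>)" for \<rho>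
      proof (rule circle.finite_measure_mono)
        show "E \<inter> cball \<zeta> \<rho> \<subseteq> F \<inter> cball \<zeta> \<rho>" using EF by auto
        have "F \<inter> cball \<zeta> \<rho> = (F \<inter> cball \<zeta> \<rho>) \<inter> sphere 0 1" using F by auto
        then show "F \<inter> cball \<zeta> \<rho> \<in> sets circle_measure"
          using circle_set_borel[of "F \<inter> cball \<zeta> \<rho>"] F unfolding circle_measure_eq by auto
      qed
      with t show "zero_density_at E \<zeta>" unfolding zero_density_at_def by (meson order_trans)
    qed
  qed
qed

text \<open>Moving from \<open>of_real r * \<zeta>\<close> to \<open>\<zeta>\<close> costs
  \<open>1 - r\<close>, which is itself at most the distance of \<open>w\<close> from
  \<open>of_real r * \<zeta>\<close>. So that distance is at least half of
  \<open>norm (w - \<zeta>)\<close>; squaring gives \<open>4\<close>, and \<open>1 + r\<close> is at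
  most \<open>2\<close>.\<close>

lemma poisson_le_dist:
  assumes w: "norm w = 1" "norm \<zeta> = 1" "w \<noteq> \<zeta>" and r: "0 < r" "r < 1"
  shows "poisson (of_real r * \<zeta>) w \<le> 8 * (1 - r) / (norm (w - \<zeta>))\<^sup>2"
proof -
  have a: "1 - r \<le> norm (w - of_real r * \<zeta>)"
    using norm_triangle_ineq2[of w "of_real r * \<zeta>"] assms by (simp add: norm_mult)
  have "norm (of_real r * \<zeta> - \<zeta>) = 1 - r"
  proof -
    have "of_real r * \<zeta> - \<zeta> = of_real (r - 1) * \<zeta>" by (simp add: algebra_simps)
    then show ?thesis using r w by (simp add: norm_mult del: of_real_diff)
  qed
  then have "norm (w - \<zeta>) / 2 \<le> norm (w - of_real r * \<zeta>)"
    using norm_triangle_ineq[of "w - of_real r * \<zeta>" "of_real r * \<zeta> - \<zeta>"] a by simp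
  then have b: "(norm (w - \<zeta>) / 2)\<^sup>2 \<le> (norm (w - of_real r * \<zeta>))\<^sup>2"
    by (intro power_mono) auto
  have "1 - r\<^sup>2 = (1 - r) * (1 + r)" by (simp add: power2_eq_square algebra_simps)
  also have "\<dots> \<le> (1 - r) * 2" using r by (intro mult_left_mono) auto
  finally have c: "1 - r\<^sup>2 \<le> 2 * (1 - r)" by simp
  have pos: "0 < (norm (w - \<zeta>) / 2)\<^sup>2" using w by simp
  have "poisson (of_real r * \<zeta>) w \<le> 2 * (1 - r) / (norm (w - \<zeta>) / 2)\<^sup>2"
    unfolding poisson_def using b c pos r w
    by (intro frac_le) (auto simp: norm_mult)
  also have "\<dots> = 8 * (1 - r) / (norm (w - \<zeta>))\<^sup>2"
    by (simp add: power_divide)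
  finally show ?thesis .
qed

text \<open>Dyadic decomposition: on the disc of radius \<open>2 ^ k * (1 - r)\<close> around \<open>\<zeta>\<close> the kernel is at most
  \<open>32 / (4 ^ k * (1 - r))\<close> outside the preceding disc.\<close>

lemma poisson_thin_bound:
  assumes E: "E \<in> sets circle_measure" and z: "norm \<zeta> = 1" and e: "e > 0" and d: "\<delta> > 0"
    and thin: "\<And>\<rho>. \<lbrakk>0 < \<rho>; \<rho> \<le> \<delta>\<rbrakk> \<Longrightarrow> measure circle_measure (E \<inter> cball \<zeta> \<rho>) \<le> e * \<rho>"
    and r: "0 < r" "r < 1" "1 - r \<le> \<delta>"
  shows "(\<integral>w. indicator E w * poisson (of_real r * \<zeta>) w \<partial>circle_measure) \<le> 64 * e + 32 * (1 - r) / \<delta>\<^sup>2"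
proof -
  define h where "h = 1 - r"
  have h: "0 < h" "h \<le> \<delta>" using r by (auto simp: h_def)
  let ?P = "\<lambda>k. 2 ^ k * h \<le> \<delta>"
  obtain N :: nat where N: "\<delta> / h < 2 ^ N" using real_arch_pow[of 2 "\<delta> / h"] by auto
  have bnd: "k \<le> N" if "?P k" for k
  proof (rule ccontr)
    assume "\<not> k \<le> N"
    then have "(2::real) ^ N \<le> 2 ^ k" by (intro power_increasing) auto
    then have "2 ^ N * h \<le> 2 ^ k * h" using h by (intro mult_right_mono) auto
    moreover have "\<delta> < 2 ^ N * h" using N h by (simp add: field_simps)
    ultimately show False using that by linarith
  qed
  \<comment> \<open>The last dyadic disc of radius at most \<open>\<delta>\<close>, the range where
    \<open>thin\<close> applies. A point outside it has distance more than
    \<open>\<delta> / 2\<close> from \<open>\<zeta>\<close>, so the kernel there is at most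
    \<open>32 * h / \<delta>\<^sup>2\<close>.\<close>
  define n where "n = (GREATEST k. ?P k)"
  have n: "2 ^ n * h \<le> \<delta>"
    unfolding n_def by (rule GreatestI_nat[of ?P 0 N]) (use h bnd in auto)
  have n': "\<delta> < 2 ^ Suc n * h"
  proof (rule ccontr)
    assume "\<not> \<delta> < 2 ^ Suc n * h"
    then have "?P (Suc n)" by simp
    then have "Suc n \<le> n" unfolding n_def by (rule Greatest_le_nat[of ?P _ N]) (use bnd in auto)
    then show False by simp
  qed
  let ?D = "\<lambda>k. E \<inter> cball \<zeta> (2 ^ k * h)"
  \<comment> \<open>The \<open>32\<close> is the \<open>8\<close> of \<open>poisson_le_dist\<close>
    times \<open>4\<close>, because outside the preceding disc the distance exceeds half of
    \<open>2 ^ k * h\<close>. For \<open>k = 0\<close> the crude bound \<open>2 / h\<close> of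
    \<open>poisson_le\<close> is enough.\<close>
  let ?c = "\<lambda>k. 32 / (4 ^ k * h) :: real"
  let ?p = "poisson (of_real r * \<zeta>)"
  have zr: "norm (of_real r * \<zeta>) < 1" "norm (of_real r * \<zeta>) = r" using z r by (auto simp: norm_mult)
  have Es: "E \<subseteq> sphere 0 1" using sets.sets_into_space[OF E] by simp
  have D: "?D k \<in> sets circle_measure" for k
  proof -
    have "?D k = E \<inter> (cball \<zeta> (2 ^ k * h) \<inter> sphere 0 1)" using Es by auto
    moreover have "cball \<zeta> (2 ^ k * h) \<inter> sphere 0 1 \<in> sets circle_measure"
      using circle_set_borel[of "cball \<zeta> (2 ^ k * h)"] unfolding circle_measure_eq by auto
    ultimately show ?thesis using E by auto
  qed
  have pt: "indicator E w * ?p w \<le> (\<Sum>k\<le>n. ?c k * indicator (?D k) w) + 32 * h / \<delta>\<^sup>2" if w: "norm w = 1" for w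
  proof (cases "w \<in> E")
    case True
    show ?thesis
    proof (cases "norm (w - \<zeta>) \<le> 2 ^ n * h")
      case le: True
      define k where "k = (LEAST k. norm (w - \<zeta>) \<le> 2 ^ k * h)"
      have k: "norm (w - \<zeta>) \<le> 2 ^ k * h" unfolding k_def by (rule LeastI[of _ n]) (rule le)
      have kn: "k \<le> n" unfolding k_def by (rule Least_le) (rule le)
      have "?p w \<le> ?c k"
      proof (cases k)
        case 0
        have "?p w \<le> 2 / h" using poisson_le[OF w zr(1)] zr(2) by (simp add: h_def)
        also have "\<dots> \<le> 32 / h" using h by (intro divide_right_mono) auto
        finally show ?thesis using 0 by simp
      next
        case (Suc j)
        have gt: "2 ^ j * h < norm (w - \<zeta>)"
          using not_less_Least[of j "\<lambda>k. norm (w - \<zeta>) \<le> 2 ^ k * h"] Suc k_def by simp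
        then have wz: "w \<noteq> \<zeta>" using h by (auto simp: mult_less_0_iff)
        have "?p w \<le> 8 * h / (norm (w - \<zeta>))\<^sup>2"
          unfolding h_def by (rule poisson_le_dist) (use w z wz r in auto)
        also have "\<dots> \<le> 8 * h / (2 ^ j * h)\<^sup>2"
          using gt h wz by (intro divide_left_mono power_mono mult_pos_pos) auto
        also have "\<dots> = ?c k"
          using h Suc by (simp add: power2_eq_square power_mult_distrib[symmetric] field_simps flip: power_mult_distrib)
        finally show ?thesis .
      qed
      also have "\<dots> = ?c k * indicator (?D k) w"
        using True k by (simp add: dist_norm norm_minus_commute)
      also have "\<dots> \<le> (\<Sum>k\<le>n. ?c k * indicator (?D k) w)"
        using kn h by (intro member_le_sum) auto
      finally show ?thesis using True h by (simp add: add_increasing2)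
    next
      case False
      then have gt: "\<delta> / 2 < norm (w - \<zeta>)" using n' by simp
      then have wz: "w \<noteq> \<zeta>" using d by auto
      have "?p w \<le> 8 * h / (norm (w - \<zeta>))\<^sup>2"
        unfolding h_def by (rule poisson_le_dist) (use w z wz r in auto)
      also have "\<dots> \<le> 8 * h / (\<delta> / 2)\<^sup>2"
        using gt h wz d by (intro divide_left_mono power_mono mult_pos_pos) auto
      also have "\<dots> = 32 * h / \<delta>\<^sup>2" by (simp add: power_divide)
      finally have "?p w \<le> 32 * h / \<delta>\<^sup>2" .
      moreover have "0 \<le> (\<Sum>k\<le>n. ?c k * indicator (?D k) w)"
        using h by (intro sum_nonneg) auto
      ultimately show ?thesis using True by simp
    qed
  next
    case False
    have "0 \<le> (\<Sum>k\<le>n. ?c k * indicator (?D k) w)"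
      using h by (intro sum_nonneg) auto
    then show ?thesis using False h by simp
  qed
  have i1: "integrable circle_measure (\<lambda>w. indicator E w * ?p w)"
  proof (rule circle_integrable_bounded)
    show "(\<lambda>w. indicator E w * ?p w) \<in> borel_measurable circle_measure" using E by measurable
    fix w :: complex assume "norm w = 1"
    then show "norm (indicator E w * ?p w) \<le> 2 / (1 - r)"
      using poisson_le[of w "of_real r * \<zeta>"] poisson_nonneg[of "of_real r * \<zeta>" w] zr r
      by (auto split: split_indicator)
  qed
  have i2: "integrable circle_measure (\<lambda>w. ?c k * indicator (?D k) w)" for k
    using D[of k] by (intro integrable_mult_right integrable_real_indicator) (auto simp: less_top[symmetric])
  have "(\<integral>w. indicator E w * ?p w \<partial>circle_measure) \<le> (\<integral>w. (\<Sum>k\<le>n. ?c k * indicator (?D k) w) + 32 * h / \<delta>\<^sup>2 \<partial>circle_measure)"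
    by (rule integral_mono[OF i1]) (use i2 pt in auto)
  also have "\<dots> = (\<Sum>k\<le>n. ?c k * measure circle_measure (?D k)) + 32 * h / \<delta>\<^sup>2"
  proof -
    have "?D k \<inter> sphere 0 1 = ?D k" for k using Es by auto
    then show ?thesis
      using i2 circle.prob_space by simp
  qed
  \<comment> \<open>The kernel decays like \<open>4 ^ k\<close> while the measure of the discs grows
    only like \<open>2 ^ k\<close>. What remains is a geometric series with sum at most
    \<open>2\<close>, hence the \<open>64\<close>.\<close>
  also have "(\<Sum>k\<le>n. ?c k * measure circle_measure (?D k)) \<le> (\<Sum>k\<le>n. 32 * e * (1/2) ^ k)"
  proof (rule sum_mono)
    fix k assume k: "k \<in> {..n}"
    have "2 ^ k * h \<le> 2 ^ n * h" using k h by (intro mult_right_mono power_increasing) auto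
    then have "2 ^ k * h \<le> \<delta>" using n by (rule order_trans)
    then have "measure circle_measure (?D k) \<le> e * (2 ^ k * h)"
      using h by (intro thin) auto
    then have "?c k * measure circle_measure (?D k) \<le> ?c k * (e * (2 ^ k * h))"
      using h by (intro mult_left_mono) auto
    also have "\<dots> = 32 * e * (2 ^ k / 4 ^ k)" using h by simp
    also have "(2 ^ k / 4 ^ k :: real) = (1/2) ^ k" by (simp flip: power_divide)
    finally show "?c k * measure circle_measure (?D k) \<le> 32 * e * (1/2) ^ k" .
  qed
  also have "(\<Sum>k\<le>n. 32 * e * (1/2) ^ k) = 32 * e * (\<Sum>k\<le>n. (1/2) ^ k)"
    by (rule sum_distrib_left[symmetric])
  also have "\<dots> \<le> 32 * e * 2"
  proof (rule mult_left_mono)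
    have "(\<Sum>k\<le>n. (1/2::real) ^ k) \<le> (\<Sum>k. (1/2) ^ k)"
      by (rule sum_le_suminf) (auto intro: summable_geometric)
    also have "\<dots> = 2" by (subst suminf_geometric) auto
    finally show "(\<Sum>k\<le>n. (1/2::real) ^ k) \<le> 2" .
  qed (use e in auto)
  finally show ?thesis by (simp add: h_def)
qed

lemma poisson_thin:
  assumes E: "E \<in> sets circle_measure" and z: "norm \<zeta> = 1" and thin: "zero_density_at E \<zeta>"
  shows "((\<lambda>r. \<integral>w. indicator E w * poisson (of_real r * \<zeta>) w \<partial>circle_measure) \<longlongrightarrow> 0) (at_left 1)"
proof (rule tendstoI)
  fix e :: real assume e: "e > 0"
  \<comment> \<open>\<open>64 * (e / 128)\<close> is half of \<open>e\<close>; the other half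
    absorbs the far part of the kernel, which vanishes as \<open>r\<close> tends to one with
    \<open>\<delta>\<close> fixed.\<close>
  obtain \<delta> where \<delta>: "\<delta> > 0" "\<And>\<rho>. \<lbrakk>0 < \<rho>; \<rho> \<le> \<delta>\<rbrakk> \<Longrightarrow> measure circle_measure (E \<inter> cball \<zeta> \<rho>) \<le> e / 128 * \<rho>"
    using thin[unfolded zero_density_at_def, rule_format, of "e/128"] e by auto
  have "((\<lambda>r. 32 * (1 - r) / \<delta>\<^sup>2) \<longlongrightarrow> 32 * (1 - 1) / \<delta>\<^sup>2) (at_left 1)"
    using \<delta> by (intro tendsto_intros) auto
  then have "\<forall>\<^sub>F r in at_left 1. 32 * (1 - r) / \<delta>\<^sup>2 < e / 2"
    by (rule order_tendstoD(2)) (use e in auto)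
  moreover have "\<forall>\<^sub>F r in at_left (1::real). max 0 (1 - \<delta>) < r \<and> r < 1"
    using eventually_at_left_real[of "max 0 (1 - \<delta>)" 1] \<delta> by (auto elim: eventually_mono)
  ultimately show "\<forall>\<^sub>F r in at_left 1. dist (\<integral>w. indicator E w * poisson (of_real r * \<zeta>) w \<partial>circle_measure) 0 < e"
  proof eventually_elim
    fix r assume r: "32 * (1 - r) / \<delta>\<^sup>2 < e / 2" "max 0 (1 - \<delta>) < r \<and> r < 1"
    have "(\<integral>w. indicator E w * poisson (of_real r * \<zeta>) w \<partial>circle_measure) \<le> 64 * (e/128) + 32 * (1 - r) / \<delta>\<^sup>2"
      by (rule poisson_thin_bound[OF E z _ \<delta>(1)]) (use \<delta>(2) e r in auto)
    also have "\<dots> < 64 * (e/128) + e / 2" using r(1) by (rule add_strict_left_mono)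
    finally have "(\<integral>w. indicator E w * poisson (of_real r * \<zeta>) w \<partial>circle_measure) < e" by simp
    moreover have "0 \<le> (\<integral>w. indicator E w * poisson (of_real r * \<zeta>) w \<partial>circle_measure)"
      using r z by (intro Bochner_Integration.integral_nonneg mult_nonneg_nonneg poisson_nonneg) (auto simp: norm_mult)
    ultimately show "dist (\<integral>w. indicator E w * poisson (of_real r * \<zeta>) w \<partial>circle_measure) 0 < e"
      by simp
  qed
qed

lemma integrable_poisson_mult:
  fixes \<phi> :: "complex \<Rightarrow> 'b::{banach, real_normed_algebra_1, second_countable_topology}"
  assumes "\<phi> \<in> borel_measurable circle_measure" "\<And>w. norm w = 1 \<Longrightarrow> norm (\<phi> w) \<le> C" "norm z < 1"
  shows "integrable circle_measure (\<lambda>w. \<phi> w * of_real (poisson z w))"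
proof (rule circle_integrable_bounded)
  show "(\<lambda>w. \<phi> w * of_real (poisson z w)) \<in> borel_measurable circle_measure"
    using assms(1) by measurable
  fix w :: complex assume w: "norm w = 1"
  have C: "0 \<le> C" using assms(2)[OF w] norm_ge_zero order_trans by blast
  have "norm (\<phi> w * of_real (poisson z w)) \<le> norm (\<phi> w) * norm (of_real (poisson z w) :: 'b)"
    by (rule norm_mult_ineq)
  also have "\<dots> \<le> C * (2 / (1 - norm z))"
    using assms(2)[OF w] poisson_le[OF w assms(3)] poisson_nonneg[of z w] assms(3) C
    by (intro mult_mono) auto
  finally show "norm (\<phi> w * of_real (poisson z w)) \<le> C * (2 / (1 - norm z))" .
qed

text \<open>The set where \<open>\<phi>\<close> is far from \<open>\<phi> \<zeta>\<close> depends on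
  \<open>\<zeta>\<close>, but density statements can be combined for countably many sets only. So
  \<open>\<phi> \<zeta>\<close> is replaced by a nearby value \<open>q\<close> from a countable
  dense set. Off the set belonging to \<open>q\<close> the function stays within
  \<open>e / 2\<close> of \<open>\<phi> \<zeta>\<close>; the set itself has zero density at
  \<open>\<zeta>\<close>, and \<open>poisson_thin\<close> makes its kernel mass vanish.\<close>

theorem fatou_poisson:
  fixes \<phi> :: "complex \<Rightarrow> complex"
  assumes \<phi>: "\<phi> \<in> borel_measurable circle_measure" "\<And>w. norm w = 1 \<Longrightarrow> norm (\<phi> w) \<le> C"
  shows "AE \<zeta> in circle_measure.
    ((\<lambda>r. \<integral>w. \<phi> w * of_real (poisson (of_real r * \<zeta>) w) \<partial>circle_measure) \<longlongrightarrow> \<phi> \<zeta>) (at_left 1)"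
proof -
  obtain Q :: "complex set" where Q: "countable Q" "\<And>X. open X \<Longrightarrow> X \<noteq> {} \<Longrightarrow> \<exists>d\<in>Q. d \<in> X"
    by (rule countable_dense_setE) blast
  define E where "E p = {w \<in> space circle_measure. dist (\<phi> w) (fst p) \<ge> 1 / real (Suc (snd p))}" for p
  have Em: "E p \<in> sets circle_measure" for p
    unfolding E_def using \<phi>(1) by measurable
  have "AE \<zeta> in circle_measure. \<forall>p\<in>Q \<times> UNIV. \<zeta> \<notin> E p \<longrightarrow> zero_density_at (E p) \<zeta>"
    using Q(1) AE_zero_density_complete[OF Em] by (subst AE_ball_countable) auto
  then have ae: "AE \<zeta> in circle_measure. (\<forall>p\<in>Q \<times> UNIV. \<zeta> \<notin> E p \<longrightarrow> zero_density_at (E p) \<zeta>) \<and> \<zeta> \<in> space circle_measure"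
    by (intro AE_conjI AE_space)
  have C: "C \<ge> 0" using \<phi>(2)[of 1] norm_ge_zero order_trans by (metis norm_one)
  show ?thesis using ae
  proof eventually_elim
    fix \<zeta> assume "(\<forall>p\<in>Q \<times> UNIV. \<zeta> \<notin> E p \<longrightarrow> zero_density_at (E p) \<zeta>) \<and> \<zeta> \<in> space circle_measure"
    then have z: "norm \<zeta> = 1" and th: "\<And>q n. q \<in> Q \<Longrightarrow> \<zeta> \<notin> E (q, n) \<Longrightarrow> zero_density_at (E (q, n)) \<zeta>" by auto
    show "((\<lambda>r. \<integral>w. \<phi> w * of_real (poisson (of_real r * \<zeta>) w) \<partial>circle_measure) \<longlongrightarrow> \<phi> \<zeta>) (at_left 1)"
    proof (rule tendstoI)
      fix e :: real assume e: "e > 0"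
      obtain n where n: "1 / real (Suc n) < e / 4" using e nat_approx_posE[of "e/4"] by auto
      obtain q where q: "q \<in> Q" "q \<in> ball (\<phi> \<zeta>) (1 / real (Suc n))"
        using Q(2)[of "ball (\<phi> \<zeta>) (1 / real (Suc n))"] by auto
      define A where "A = E (q, n)"
      have A: "A \<in> sets circle_measure" unfolding A_def by (rule Em)
      have "\<zeta> \<notin> A" using q by (auto simp: A_def E_def)
      then have thA: "zero_density_at A \<zeta>" unfolding A_def by (rule th[OF q(1)])
      have dif: "norm (\<phi> w - \<phi> \<zeta>) \<le> e / 2 + 2 * C * indicator A w" if w: "norm w = 1" for w
      proof (cases "w \<in> A")
        case True
        have "norm (\<phi> w - \<phi> \<zeta>) \<le> norm (\<phi> w) + norm (\<phi> \<zeta>)" by (rule norm_triangle_ineq4)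
        also have "\<dots> \<le> C + C" by (intro add_mono \<phi>(2) w z)
        finally show ?thesis using True e by simp
      next
        case False
        then have "dist (\<phi> w) q < 1 / real (Suc n)" using w by (auto simp: A_def E_def)
        then have "dist (\<phi> w) (\<phi> \<zeta>) < e/4 + e/4"
          using n q dist_triangle[of "\<phi> w" "\<phi> \<zeta>" q] by (simp add: dist_commute)
        then show ?thesis using False by (simp add: dist_norm)
      qed
      \<comment> \<open>Chosen so that the mass times \<open>2 * C\<close> stays below
        \<open>e / 2\<close>; the \<open>+ 1\<close> covers \<open>C = 0\<close>.\<close>
      have "\<forall>\<^sub>F r in at_left 1. dist (\<integral>w. indicator A w * poisson (of_real r * \<zeta>) w \<partial>circle_measure) 0 < e / (4 * (C + 1))"
        using poisson_thin[OF A z thA] by (rule tendstoD) (use e C in auto)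
      moreover have "\<forall>\<^sub>F r in at_left (1::real). 0 < r \<and> r < 1"
        using eventually_at_left_real[of 0 "1::real"] by (auto elim: eventually_mono)
      ultimately show "\<forall>\<^sub>F r in at_left 1. dist (\<integral>w. \<phi> w * of_real (poisson (of_real r * \<zeta>) w) \<partial>circle_measure) (\<phi> \<zeta>) < e"
      proof eventually_elim
        fix r assume sm: "dist (\<integral>w. indicator A w * poisson (of_real r * \<zeta>) w \<partial>circle_measure) 0 < e / (4 * (C + 1))" and r: "0 < r \<and> r < 1"
        let ?p = "poisson (of_real r * \<zeta>)"
        have zr: "norm (of_real r * \<zeta>) < 1" using z r by (simp add: norm_mult)
        have ia: "integrable circle_measure (\<lambda>w. indicator A w * ?p w)"
          using integrable_poisson_mult[of "indicator A :: complex \<Rightarrow> real" 1, OF _ _ zr] A by (auto split: split_indicator)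
        have ip: "integrable circle_measure ?p"
          using integrable_poisson_mult[of "\<lambda>_. 1::real" 1, OF _ _ zr] by auto
        have ipc: "integrable circle_measure (\<lambda>w. \<phi> \<zeta> * complex_of_real (?p w))"
          using ip by simp
        have "(\<integral>w. \<phi> \<zeta> * complex_of_real (?p w) \<partial>circle_measure) = \<phi> \<zeta>"
          using integral_poisson[OF zr] by simp
        then have "(\<integral>w. \<phi> w * of_real (?p w) \<partial>circle_measure) - \<phi> \<zeta> = (\<integral>w. \<phi> w * of_real (?p w) - \<phi> \<zeta> * of_real (?p w) \<partial>circle_measure)"
          by (subst Bochner_Integration.integral_diff[OF integrable_poisson_mult[OF \<phi> zr] ipc]) auto
        also have "norm \<dots> \<le> (\<integral>w. e / 2 * ?p w + 2 * C * (indicator A w * ?p w) \<partial>circle_measure)"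
        proof (rule Bochner_Integration.integral_norm_bound_integral)
          show "integrable circle_measure (\<lambda>w. \<phi> w * of_real (?p w) - \<phi> \<zeta> * of_real (?p w))"
            by (intro Bochner_Integration.integrable_diff integrable_poisson_mult[OF \<phi> zr] ipc)
          show "integrable circle_measure (\<lambda>w. e / 2 * ?p w + 2 * C * (indicator A w * ?p w))"
            using ia ip by auto
          fix w assume "w \<in> space circle_measure"
          then have w: "norm w = 1" by simp
          have "norm (\<phi> w * of_real (?p w) - \<phi> \<zeta> * of_real (?p w)) = norm (\<phi> w - \<phi> \<zeta>) * ?p w"
            using poisson_nonneg[of "of_real r * \<zeta>" w] zr by (simp flip: left_diff_distrib add: norm_mult)
          also have "\<dots> \<le> (e / 2 + 2 * C * indicator A w) * ?p w"
            using poisson_nonneg[of "of_real r * \<zeta>" w] zr dif[OF w] by (intro mult_right_mono) auto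
          finally show "norm (\<phi> w * of_real (?p w) - \<phi> \<zeta> * of_real (?p w)) \<le> e / 2 * ?p w + 2 * C * (indicator A w * ?p w)"
            by (simp add: algebra_simps)
        qed
        also have "\<dots> = e / 2 + 2 * C * (\<integral>w. indicator A w * ?p w \<partial>circle_measure)"
          using ia ip integral_poisson[OF zr] by simp
        also have "\<dots> < e"
        proof -
          have "2 * C * (\<integral>w. indicator A w * ?p w \<partial>circle_measure) \<le> 2 * C * (e / (4 * (C + 1)))"
            using sm C by (intro mult_left_mono) auto
          also have "\<dots> < e / 2" using e C by (simp add: field_simps)
          finally show ?thesis by simp
        qed
        finally show "dist (\<integral>w. \<phi> w * of_real (poisson (of_real r * \<zeta>) w) \<partial>circle_measure) (\<phi> \<zeta>) < e"
          by (simp add: dist_norm)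
      qed
    qed
  qed
qed

section \<open>Boundary maps of inner functions\<close>

text \<open>Preimages under \<open>f\<close> and \<open>g\<close> differ by a subset of a null set,
  which is measurable by completeness. This makes the arbitrary values of a boundary map on its
  exceptional set harmless.\<close>

lemma (in complete_measure) measurable_cong_AE_complete:
  assumes f: "f \<in> M \<rightarrow>\<^sub>M N" and g: "g \<in> space M \<rightarrow> space N" and ae: "AE x in M. f x = g x"
  shows "g \<in> M \<rightarrow>\<^sub>M N"
proof (rule measurableI)
  show "g x \<in> space N" if "x \<in> space M" for x using g that by auto
  fix A assume A: "A \<in> sets N"
  show "g -` A \<inter> space M \<in> sets M"
  proof (rule in_sets_AE)
    show "f -` A \<inter> space M \<in> sets M" using f A by (rule measurable_sets)
    show "AE x in M. (x \<in> f -` A \<inter> space M) = (x \<in> g -` A \<inter> space M)"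
      using ae by eventually_elim auto
  qed auto
qed

lemma has_radial_limit_unique:
  "\<lbrakk>has_radial_limit g z w; has_radial_limit g z w'\<rbrakk> \<Longrightarrow> w = w'"
  unfolding has_radial_limit_def using tendsto_unique trivial_limit_at_left_real by blast

lemma boundary_map_eqI:
  assumes "has_radial_limit g z w" "norm w = 1"
  shows "boundary_map g z = w"
  unfolding boundary_map_def using assms has_radial_limit_unique by (auto intro!: the_equality)

text \<open>Holds at every point thanks to the default value, so estimates on the circle apply to
  boundary values without any exceptional set.\<close>

lemma norm_boundary_map [simp]: "norm (boundary_map g z) = 1"
proof (cases "\<exists>w. has_radial_limit g z w \<and> norm w = 1")
  case True
  then show ?thesis using boundary_map_eqI by blast
next
  case False
  then show ?thesis by (simp only: boundary_map_def if_False norm_one)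
qed

lemma AE_radial_limit:
  assumes "inner_function g"
  shows "AE z in circle_measure. has_radial_limit g z (boundary_map g z)"
proof -
  have "AE z in circle_measure. \<exists>w. has_radial_limit g z w \<and> norm w = 1"
    using assms by (simp add: inner_function_def)
  then show ?thesis by eventually_elim (use boundary_map_eqI in blast)
qed

lemma inner_holomorphic: "inner_function g \<Longrightarrow> g holomorphic_on ball 0 1"
  by (simp add: inner_function_def)

lemma inner_norm_less: "inner_function g \<Longrightarrow> norm z < 1 \<Longrightarrow> norm (g z) < 1"
  by (auto simp: inner_function_def Pi_iff)

text \<open>The limit of the continuous dilates along \<open>rad\<close> is measurable and agrees
  almost everywhere with the boundary map.\<close>

lemma borel_measurable_boundary_map [measurable (raw)]:
  assumes g: "inner_function g"
  shows "boundary_map g \<in> borel_measurable circle_measure"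
proof (rule circle_complete.measurable_cong_AE_complete)
  show "(\<lambda>z. lim (\<lambda>n. g (of_real (rad n) * z))) \<in> borel_measurable circle_measure"
    by (intro borel_measurable_lim_metric measurable_dilate inner_holomorphic g rad_bounds)
  show "AE z in circle_measure. lim (\<lambda>n. g (of_real (rad n) * z)) = boundary_map g z"
    using AE_radial_limit[OF g]
    by eventually_elim (auto dest: radial_limit_rad intro: limI)
qed auto

lemma integral_radial_limit:
  assumes F: "F holomorphic_on ball 0 1" "\<And>w. norm w < 1 \<Longrightarrow> norm (F w) \<le> C"
    and \<phi>: "\<phi> \<in> borel_measurable circle_measure" "AE w in circle_measure. has_radial_limit F w (\<phi> w)"
  shows "(\<integral>w. \<phi> w \<partial>circle_measure) = F 0"
proof -
  have "(\<integral>w. \<phi> w \<partial>circle_measure) = (\<integral>w. \<phi> w * of_real (poisson 0 w) \<partial>circle_measure)"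
    by (rule Bochner_Integration.integral_cong) (auto simp: poisson_def)
  also have "\<dots> = F 0" by (rule poisson_integral_radial_limit[OF assms]) auto
  finally show ?thesis .
qed

section \<open>Invariance of arc length under boundary maps\<close>

lemma norm_cnj_mult_le_and_nonzero:
  assumes "norm z < 1" "norm w \<le> 1"
  shows "norm (cnj z * w) \<le> norm z" "1 - cnj z * w \<noteq> 0"
proof -
  show le: "norm (cnj z * w) \<le> norm z"
    using mult_left_mono[OF assms(2), of "norm z"] by (simp add: norm_mult)
  show "1 - cnj z * w \<noteq> 0"
    using le assms by (metis eq_iff_diff_eq_0 linorder_not_less norm_one)
qed

text \<open>The familiar \<open>(w + z) / (w - z)\<close> is holomorphic in \<open>z\<close>. For
  \<open>w\<close> on the circle its conjugate is the quotient used here, which has the same real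
  part and is holomorphic in \<open>w\<close>; so an inner function can be substituted for
  \<open>w\<close>, and a geometric series in \<open>w\<close> can be expanded.\<close>

lemma poisson_eq_Re:
  assumes z: "norm z < 1" and w: "norm w = 1"
  shows "poisson z w = Re ((1 + cnj z * w) / (1 - cnj z * w))"
proof -
  have nz: "1 - cnj z * w \<noteq> 0" using norm_cnj_mult_le_and_nonzero[OF z, of w] w by simp
  have "w * cnj w = 1" using w by (simp add: complex_norm_square[symmetric])
  then have e: "1 - cnj z * w = w * cnj (w - z)" by (simp add: algebra_simps)
  have n: "norm (1 - cnj z * w) = norm (w - z)"
    unfolding e norm_mult complex_mod_cnj w by simp
  have "(1 + cnj z * w) / (1 - cnj z * w) = (1 + cnj z * w) * cnj (1 - cnj z * w) / of_real ((norm (1 - cnj z * w))\<^sup>2)"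
    unfolding complex_norm_square using nz
    by (intro mult_divide_mult_cancel_right[symmetric]) (simp only: complex_cnj_zero_iff not_False_eq_True)
  also have "Re \<dots> = Re ((1 + cnj z * w) * cnj (1 - cnj z * w)) / (norm (w - z))\<^sup>2"
    unfolding n Re_divide_of_real ..
  also have "(1 + cnj z * w) * cnj (1 - cnj z * w) = 1 - of_real ((norm (cnj z * w))\<^sup>2) + (cnj z * w - cnj (cnj z * w))"
    unfolding complex_norm_square by (simp add: algebra_simps)
  also have "Re \<dots> = 1 - (norm z)\<^sup>2"
    using w by (simp add: norm_mult)
  finally show ?thesis by (simp add: poisson_def)
qed

text \<open>Invariance of the measure, tested on Poisson kernels. The kernel is the real part of
  \<open>H\<close>, and \<open>H\<close> composed with \<open>f\<close> is bounded and holomorphic,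
  so the mean of its radial limits is its value \<open>H 0 = 1\<close> at the origin.\<close>

lemma integral_poisson_boundary:
  assumes f: "inner_function f" "f 0 = 0" and z: "norm z < 1"
  shows "(\<integral>w. poisson z (boundary_map f w) \<partial>circle_measure) = 1"
proof -
  define H where "H w = (1 + cnj z * w) / (1 - cnj z * w)" for w
  note sm = norm_cnj_mult_le_and_nonzero(1)[OF z] and nz = norm_cnj_mult_le_and_nonzero(2)[OF z]
  have Re: "Re (H w) = poisson z w" if "norm w = 1" for w
    unfolding H_def by (rule poisson_eq_Re[OF z that, symmetric])
  have holH: "H holomorphic_on ball 0 1"
    unfolding H_def by (intro holomorphic_intros) (use nz in auto)
  have contH: "isCont H w" if "norm w = 1" for w
    unfolding H_def using nz[of w] that by (intro continuous_intros) auto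
  have Hb: "norm (H w) \<le> 2 / (1 - norm z)" if "norm w \<le> 1" for w
    unfolding H_def norm_divide
  proof (rule frac_le)
    show "norm (1 + cnj z * w) \<le> 2" using norm_triangle_ineq[of 1 "cnj z * w"] sm[OF that] z by simp
    show "1 - norm z \<le> norm (1 - cnj z * w)" using norm_triangle_ineq2[of 1 "cnj z * w"] sm[OF that] by simp
  qed (use z in auto)
  have bm: "boundary_map f \<in> borel_measurable circle_measure" using f by simp
  have Hm: "(\<lambda>w. H (boundary_map f w)) \<in> borel_measurable circle_measure"
    unfolding H_def using bm by measurable
  have "(\<integral>w. H (boundary_map f w) \<partial>circle_measure) = H (f 0)"
  proof (rule integral_radial_limit[OF _ _ Hm, where C="2 / (1 - norm z)"])
    show "(\<lambda>w. H (f w)) holomorphic_on ball 0 1"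
      by (rule holomorphic_on_compose_gen[unfolded o_def, OF inner_holomorphic[OF f(1)] holH])
         (use inner_norm_less[OF f(1)] in auto)
    show "norm (H (f w)) \<le> 2 / (1 - norm z)" if "norm w < 1" for w
      using Hb inner_norm_less[OF f(1) that] by simp
    show "AE w in circle_measure. has_radial_limit (\<lambda>w. H (f w)) w (H (boundary_map f w))"
      using AE_radial_limit[OF f(1)]
    proof eventually_elim
      fix w assume "has_radial_limit f w (boundary_map f w)"
      then show "has_radial_limit (\<lambda>w. H (f w)) w (H (boundary_map f w))"
        unfolding has_radial_limit_def by (rule isCont_tendsto_compose[OF contH, rotated]) simp
    qed
  qed
  then have "Re (\<integral>w. H (boundary_map f w) \<partial>circle_measure) = 1" using f by (simp add: H_def)
  also have "Re (\<integral>w. H (boundary_map f w) \<partial>circle_measure) = (\<integral>w. Re (H (boundary_map f w)) \<partial>circle_measure)"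
    by (rule integral_Re[symmetric]) (rule circle_integrable_bounded[OF Hm Hb], simp)
  finally show ?thesis by (simp add: Re)
qed

text \<open>For unit vectors the kernel depends only on \<open>r\<close> and the inner product of
  the two points. In the Fubini argument below this shifts the dilation from the boundary value to
  the integration variable.\<close>

lemma poisson_swap:
  assumes "norm w = 1" "norm v = 1"
  shows "poisson (of_real r * w) v = poisson (of_real r * v) w"
proof -
  have e: "(norm (a - of_real r * b))\<^sup>2 = 1 + r\<^sup>2 - 2 * r * (a \<bullet> b)" if "norm a = 1" "norm b = 1" for a b :: complex
  proof -
    have "(norm (a - of_real r * b))\<^sup>2 = (a - r *\<^sub>R b) \<bullet> (a - r *\<^sub>R b)"
      by (simp add: power2_norm_eq_inner scaleR_conv_of_real)
    also have "\<dots> = a \<bullet> a + r\<^sup>2 * (b \<bullet> b) - 2 * r * (a \<bullet> b)"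
      by (simp add: inner_diff_left inner_diff_right inner_commute power2_eq_square algebra_simps)
    also have "\<dots> = 1 + r\<^sup>2 - 2 * r * (a \<bullet> b)"
      using that by (simp add: power2_norm_eq_inner[symmetric])
    finally show ?thesis .
  qed
  show ?thesis unfolding poisson_def e[OF assms] e[OF assms(2,1)] using assms
    by (simp add: norm_mult inner_commute)
qed

lemma vimage_boundary_sets:
  assumes "inner_function f" "B \<in> sets borel"
  shows "boundary_map f -` B \<inter> sphere 0 1 \<in> sets circle_measure"
  using measurable_sets[OF borel_measurable_boundary_map[OF assms(1)] assms(2)] by simp

text \<open>The Poisson integral \<open>u n\<close> of the indicator of \<open>U\<close> tends to \<open>1\<close> everywhere on \<open>U\<close>, so no statement about null sets
  has to be transported along the boundary map; by Fubini its mean along the boundary map is the measure of \<open>U\<close>.\<close>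

lemma open_vimage_boundary_le:
  assumes f: "inner_function f" "f 0 = 0" and U: "open U"
  shows "measure circle_measure (boundary_map f -` U \<inter> sphere 0 1) \<le> measure circle_measure (U \<inter> sphere 0 1)"
proof -
  let ?M = circle_measure and ?T = "boundary_map f"
  have T [measurable]: "?T \<in> borel_measurable ?M" using f by simp
  have Us: "A \<inter> sphere 0 1 \<in> sets ?M" if "A \<in> sets borel" for A
    unfolding circle_measure_eq using circle_set_borel[OF that] by auto
  have id [measurable]: "(\<lambda>x. x) \<in> borel_measurable ?M" by (rule borel_measurable_circle) auto
  have Ub [measurable]: "U \<in> sets borel" using U by simp
  have iU [measurable]: "(indicator U :: complex \<Rightarrow> real) \<in> borel_measurable ?M"
    by (rule borel_measurable_circle) measurable
  define u where "u n w = (\<integral>v. indicator U v * poisson (of_real (rad n) * w) v \<partial>?M)" for n w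
  have radz: "norm (of_real (rad n) * w) < 1" if "norm w = 1" for n and w :: complex
    using norm_dilate[OF rad_bounds] that by simp
  have iub: "integrable ?M (\<lambda>v. indicator U v * poisson (of_real (rad n) * w) v)" if "norm w = 1" for n w
    using integrable_poisson_mult[of "indicator U :: complex \<Rightarrow> real" 1 "of_real (rad n) * w", OF iU _ radz[OF that]]
    by (auto split: split_indicator)
  have ip: "integrable ?M (poisson (of_real (rad n) * w))" if "norm w = 1" for n w
    using integrable_poisson_mult[of "\<lambda>_. 1 :: real" 1 "of_real (rad n) * w", OF _ _ radz[OF that]] by simp
  have u0: "0 \<le> u n w" if "norm w = 1" for n w
    unfolding u_def using radz[OF that, of n]
    by (intro Bochner_Integration.integral_nonneg mult_nonneg_nonneg poisson_nonneg) auto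
  have u1: "u n w \<le> 1" if "norm w = 1" for n w
  proof -
    have "u n w \<le> (\<integral>v. poisson (of_real (rad n) * w) v \<partial>?M)"
      unfolding u_def using radz[OF that, of n]
      by (intro integral_mono iub ip that) (auto split: split_indicator intro: poisson_nonneg)
    then show ?thesis using integral_poisson[OF radz[OF that]] by simp
  qed
  have ulim: "(\<lambda>n. u n w) \<longlonglongrightarrow> 1" if w: "norm w = 1" "w \<in> U" for w
  proof -
    let ?E = "- U \<inter> sphere 0 1"
    have E: "?E \<in> sets ?M" by (rule Us) (use U in auto)
    obtain d where d: "d > 0" "cball w d \<subseteq> U" using U w open_contains_cball by blast
    have "zero_density_at ?E w"
      unfolding zero_density_at_def
    proof (intro allI impI exI[of _ d] conjI)
      fix \<epsilon> \<rho> :: real assume a: "0 < \<epsilon>" "0 < \<rho> \<and> \<rho> \<le> d"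
      then have "cball w \<rho> \<subseteq> U" using d subset_cball[of \<rho> d w] by auto
      then have "?E \<inter> cball w \<rho> = {}" by auto
      then show "measure ?M (?E \<inter> cball w \<rho>) \<le> \<epsilon> * \<rho>" using a by simp
    qed (rule d(1))
    from poisson_thin[OF E w(1) this]
    have "(\<lambda>n. \<integral>v. indicator ?E v * poisson (of_real (rad n) * w) v \<partial>?M) \<longlonglongrightarrow> 0"
      by (rule filterlim_compose[OF _ rad_tendsto])
    moreover have "(\<integral>v. indicator ?E v * poisson (of_real (rad n) * w) v \<partial>?M) = 1 - u n w" for n
    proof -
      have "(\<integral>v. indicator ?E v * poisson (of_real (rad n) * w) v \<partial>?M) =
        (\<integral>v. poisson (of_real (rad n) * w) v - indicator U v * poisson (of_real (rad n) * w) v \<partial>?M)"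
        by (rule Bochner_Integration.integral_cong) (auto split: split_indicator)
      also have "\<dots> = 1 - u n w"
        unfolding u_def using integral_poisson[OF radz[OF w(1)]]
        by (subst Bochner_Integration.integral_diff[OF ip[OF w(1)] iub[OF w(1)]]) simp
      finally show ?thesis .
    qed
    ultimately have "(\<lambda>n. 1 - u n w) \<longlonglongrightarrow> 0" by simp
    from tendsto_diff[OF tendsto_const[of 1] this] show ?thesis by simp
  qed
  have Tm: "(\<lambda>z. indicator U (?T z) :: real) \<in> borel_measurable ?M"
    by measurable
  interpret P: pair_sigma_finite ?M ?M ..
  have joint: "(\<lambda>p. indicator U (snd p) * poisson (of_real (rad n) * ?T (fst p)) (snd p)) \<in> borel_measurable (?M \<Otimes>\<^sub>M ?M)" for n
  proof -
    have [measurable]: "(\<lambda>p. ?T (fst p)) \<in> borel_measurable (?M \<Otimes>\<^sub>M ?M)" "snd \<in> borel_measurable (?M \<Otimes>\<^sub>M ?M)"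
      using measurable_compose[OF measurable_fst T] measurable_compose[OF measurable_snd id] by auto
    show ?thesis unfolding poisson_def by measurable
  qed
  have mean: "(\<integral>z. u n (?T z) \<partial>?M) = measure ?M (U \<inter> sphere 0 1)"
    and um: "(\<lambda>z. u n (?T z)) \<in> borel_measurable ?M" for n
  proof -
    let ?f = "\<lambda>z v. indicator U v * poisson (of_real (rad n) * ?T z) v"
    have int: "integrable (?M \<Otimes>\<^sub>M ?M) (case_prod ?f)"
    proof -
      interpret PP: pair_prob_space ?M ?M ..
      show ?thesis
      proof (rule PP.P.integrable_const_bound)
        show "case_prod ?f \<in> borel_measurable (?M \<Otimes>\<^sub>M ?M)" using joint[of n] by (simp add: split_beta')
        show "AE x in ?M \<Otimes>\<^sub>M ?M. norm (case_prod ?f x) \<le> 2 / (1 - rad n)"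
        proof (rule AE_I2, clarify)
          fix z v assume "(z, v) \<in> space (?M \<Otimes>\<^sub>M ?M)"
          then have v: "norm v = 1" by (simp add: space_pair_measure)
          show "norm (?f z v) \<le> 2 / (1 - rad n)"
            using poisson_le[OF v radz[of "?T z" n]] poisson_nonneg[of "of_real (rad n) * ?T z" v] radz[of "?T z" n] rad_bounds[of n]
            by (auto split: split_indicator simp: norm_mult)
        qed
      qed
    qed
    have "(\<integral>z. u n (?T z) \<partial>?M) = (\<integral>z. \<integral>v. ?f z v \<partial>?M \<partial>?M)"
      by (simp add: u_def)
    also have "\<dots> = (\<integral>v. \<integral>z. ?f z v \<partial>?M \<partial>?M)"
      by (rule P.Fubini_integral[OF int, symmetric])
    also have "\<dots> = (\<integral>v. indicator U v \<partial>?M)"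
    proof (rule Bochner_Integration.integral_cong)
      fix v assume "v \<in> space ?M"
      then have v: "norm v = 1" by simp
      \<comment> \<open>After the swap the pole of the kernel no longer depends on \<open>z\<close>,
        so \<open>integral_poisson_boundary\<close> evaluates the integral along the boundary map to
        \<open>1\<close>.\<close>
      have "(\<integral>z. ?f z v \<partial>?M) = indicator U v * (\<integral>z. poisson (of_real (rad n) * v) (?T z) \<partial>?M)"
        using poisson_swap[OF norm_boundary_map v] by simp
      then show "(\<integral>z. ?f z v \<partial>?M) = indicator U v"
        using integral_poisson_boundary[OF f radz[OF v]] by simp
    qed simp
    also have "\<dots> = measure ?M (U \<inter> sphere 0 1)" by simp
    finally show "(\<integral>z. u n (?T z) \<partial>?M) = measure ?M (U \<inter> sphere 0 1)" .
    show "(\<lambda>z. u n (?T z)) \<in> borel_measurable ?M"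
      unfolding u_def using P.integrable_fst[OF int] by (rule borel_measurable_integrable)
  qed
  \<comment> \<open>The limit of \<open>u n\<close> is known on \<open>U\<close> only, so the
    indicator cuts off the rest. As \<open>u n\<close> is nonnegative, removing the indicator
    afterwards only enlarges the integral, which is why an inequality results.\<close>
  have "(\<lambda>n. \<integral>z. indicator U (?T z) * u n (?T z) \<partial>?M) \<longlonglongrightarrow> (\<integral>z. indicator U (?T z) \<partial>?M)"
  proof (rule integral_dominated_convergence[where w="\<lambda>_. 1"])
    show "AE z in ?M. (\<lambda>n. indicator U (?T z) * u n (?T z)) \<longlonglongrightarrow> indicator U (?T z)"
      using ulim by (intro AE_I2) (auto split: split_indicator)
    show "AE z in ?M. norm (indicator U (?T z) * u n (?T z)) \<le> 1" for n
      using u0 u1 by (intro AE_I2) (auto split: split_indicator)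
  qed (use um Tm in auto)
  then have "(\<integral>z. indicator U (?T z) \<partial>?M) \<le> measure ?M (U \<inter> sphere 0 1)"
  proof (rule LIMSEQ_le_const2, intro exI allI impI)
    fix n
    have "(\<integral>z. indicator U (?T z) * u n (?T z) \<partial>?M) \<le> (\<integral>z. u n (?T z) \<partial>?M)"
    proof (rule integral_mono)
      show "integrable ?M (\<lambda>z. u n (?T z))"
        by (rule circle_integrable_bounded[OF um, of _ 1]) (use u0 u1 in auto)
      show "integrable ?M (\<lambda>z. indicator U (?T z) * u n (?T z))"
        by (rule circle_integrable_bounded[of _ 1]) (use u0 u1 um Tm in \<open>auto split: split_indicator\<close>)
    qed (use u0 in \<open>auto split: split_indicator\<close>)
    then show "(\<integral>z. indicator U (?T z) * u n (?T z) \<partial>?M) \<le> measure ?M (U \<inter> sphere 0 1)"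
      using mean by simp
  qed
  also have "(\<integral>z. indicator U (?T z) \<partial>?M) = (\<integral>z. indicator (?T -` U \<inter> sphere 0 1) z \<partial>?M :: real)"
    by (rule Bochner_Integration.integral_cong) (auto split: split_indicator)
  also have "\<dots> = measure ?M (?T -` U \<inter> sphere 0 1)"
    using vimage_boundary_sets[OF f(1) Ub] by simp
  finally show ?thesis .
qed

text \<open>Outer regularity extends the inequality from open to Borel sets. Applied to a set and to
  its complement, it becomes an equality because both total masses are one.\<close>

lemma measure_vimage_boundary:
  assumes f: "inner_function f" "f 0 = 0" and B: "B \<in> sets borel"
  shows "measure circle_measure (boundary_map f -` B \<inter> sphere 0 1) = measure circle_measure (B \<inter> sphere 0 1)"
proof -
  let ?M = circle_measure and ?T = "boundary_map f"
  have T: "?T \<in> borel_measurable ?M" using f by simp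
  have id: "(\<lambda>x. x) \<in> borel_measurable ?M" by (rule borel_measurable_circle) auto
  define \<mu> where "\<mu> = distr ?M borel (\<lambda>x. x)"
  define \<nu> where "\<nu> = distr ?M borel ?T"
  have em: "emeasure \<mu> B = ennreal (measure ?M (B \<inter> sphere 0 1))"
    and en: "emeasure \<nu> B = ennreal (measure ?M (?T -` B \<inter> sphere 0 1))" if "B \<in> sets borel" for B
    using that by (simp_all add: \<mu>_def \<nu>_def emeasure_distr[OF id] emeasure_distr[OF T] circle.emeasure_eq_measure)
  have le: "measure ?M (?T -` B \<inter> sphere 0 1) \<le> measure ?M (B \<inter> sphere 0 1)" if B: "B \<in> sets borel" for B
  proof -
    have "emeasure \<nu> B \<le> (INF U \<in> {U. B \<subseteq> U \<and> open U}. emeasure \<mu> U)"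
    proof (rule INF_greatest)
      fix U assume "U \<in> {U. B \<subseteq> U \<and> open U}"
      then have U: "B \<subseteq> U" "open U" by auto
      have "emeasure \<nu> B \<le> emeasure \<nu> U" using U by (intro emeasure_mono) (auto simp: \<nu>_def)
      also have "\<dots> \<le> emeasure \<mu> U"
        using U open_vimage_boundary_le[OF f U(2)] by (simp add: em en ennreal_leI)
      finally show "emeasure \<nu> B \<le> emeasure \<mu> U" .
    qed
    also have "\<dots> = emeasure \<mu> B"
      by (rule outer_regular[symmetric]) (use B em[of UNIV] in \<open>auto simp: \<mu>_def\<close>)
    finally show ?thesis by (simp add: em[OF B] en[OF B])
  qed
  have "measure ?M (?T -` (- B) \<inter> sphere 0 1) = 1 - measure ?M (?T -` B \<inter> sphere 0 1)"
  proof -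
    have "?T -` (- B) \<inter> sphere 0 1 = space ?M - (?T -` B \<inter> sphere 0 1)" by auto
    then show ?thesis using circle.prob_compl[OF vimage_boundary_sets[OF f(1) B]] by metis
  qed
  moreover have "measure ?M (- B \<inter> sphere 0 1) = 1 - measure ?M (B \<inter> sphere 0 1)"
  proof -
    have "- B \<inter> sphere 0 1 = space ?M - (B \<inter> sphere 0 1)" by auto
    moreover have "B \<inter> sphere 0 1 \<in> sets ?M"
      unfolding circle_measure_eq using circle_set_borel[OF B] by auto
    ultimately show ?thesis using circle.prob_compl by metis
  qed
  ultimately show ?thesis using le[OF B] le[of "- B"] B by auto
qed

text \<open>Equality on Borel sets makes preimages of null sets null, so measurability and the image
  measure both pass to the completion.\<close>

theorem measure_preserving_boundary:
  assumes f: "inner_function f" "f 0 = 0"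
  shows "measure_preserving_map circle_measure (boundary_map f)"
proof -
  have T: "boundary_map f \<in> circle_measure \<rightarrow>\<^sub>M circle_base"
  proof -
    have "boundary_map f \<in> circle_measure \<rightarrow>\<^sub>M borel_circle"
      by (rule measurable_restrict_space2) (use f in auto)
    then show ?thesis by (simp cong: measurable_cong_sets add: sets_circle_base)
  qed
  have d: "distr circle_measure circle_base (boundary_map f) = circle_base"
  proof (rule measure_eqI)
    fix A assume "A \<in> sets (distr circle_measure circle_base (boundary_map f))"
    then have A: "A \<in> sets circle_base" by simp
    then have Ab: "A \<in> sets borel" "A \<inter> sphere 0 1 = A"
      by (auto simp: sets_circle_base sets_restrict_space_iff)
    have "emeasure (distr circle_measure circle_base (boundary_map f)) A = emeasure circle_measure A"
      using measure_vimage_boundary[OF f Ab(1)] Ab(2)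
      by (simp add: emeasure_distr[OF T A] circle.emeasure_eq_measure)
    also have "\<dots> = emeasure circle_base A"
      unfolding circle_measure_eq using A by simp
    finally show "emeasure (distr circle_measure circle_base (boundary_map f)) A = emeasure circle_base A" .
  qed simp
  have "boundary_map f \<in> circle_measure \<rightarrow>\<^sub>M circle_measure"
    using circle_complete.measurable_completion2[OF T] d unfolding circle_measure_eq[symmetric] by simp
  moreover have "distr circle_measure circle_measure (boundary_map f) = circle_measure"
    using circle_complete.completion_distr_eq[OF T] unfolding d circle_measure_eq[symmetric] by simp
  ultimately show ?thesis by (simp add: measure_preserving_map_def)
qed

section \<open>Boundary values of compositions and their Fourier coefficients\<close>

lemma AE_boundary_comp:
  assumes "inner_function f" "f 0 = 0" "AE z in circle_measure. P z"
  shows "AE z in circle_measure. P (boundary_map f z)"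
proof -
  have T: "boundary_map f \<in> circle_measure \<rightarrow>\<^sub>M circle_measure"
    and d: "distr circle_measure circle_measure (boundary_map f) = circle_measure"
    using measure_preserving_boundary[OF assms(1,2)] by (simp_all add: measure_preserving_map_def)
  show ?thesis by (rule AE_distrD[OF T, of P, unfolded d, OF assms(3)])
qed

text \<open>For the Poisson formula, \<open>h\<close> is first dilated. The dilate is continuous on
  the closed disc, so radial limits of \<open>f\<close> pass through it. Then the dilation is
  removed: inside the disc by continuity of \<open>h\<close>, on the circle by dominated
  convergence. The latter uses that the boundary map of \<open>f\<close> almost never hits the null
  set where \<open>h\<close> has no suitable radial limit.\<close>

theorem inner_compose:
  assumes f: "inner_function f" "f 0 = 0" and h: "inner_function h"
  shows "inner_function (h \<circ> f)"
    and "AE z in circle_measure. boundary_map (h \<circ> f) z = boundary_map h (boundary_map f z)"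
proof -
  let ?M = circle_measure
  define \<phi> where "\<phi> z = boundary_map h (boundary_map f z)" for z
  have T: "boundary_map f \<in> ?M \<rightarrow>\<^sub>M ?M"
    using measure_preserving_boundary[OF f] by (simp add: measure_preserving_map_def)
  have \<phi>m: "\<phi> \<in> borel_measurable ?M"
    unfolding \<phi>_def by (rule measurable_compose[OF T borel_measurable_boundary_map[OF h]])
  have holo: "(h \<circ> f) holomorphic_on ball 0 1"
    by (rule holomorphic_on_compose_gen[OF inner_holomorphic[OF f(1)] inner_holomorphic[OF h]])
       (use inner_norm_less[OF f(1)] in auto)
  have rep: "(\<integral>w. \<phi> w * of_real (poisson z w) \<partial>?M) = h (f z)" if z: "norm z < 1" for z
  proof -
    let ?h = "\<lambda>n w. h (of_real (rad n) * w)"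
    have hol: "?h n holomorphic_on ball 0 1" for n
      by (rule holomorphic_dilate[OF inner_holomorphic[OF h] rad_bounds])
    have bd: "norm (?h n w) \<le> 1" if "norm w \<le> 1" for n w
      using inner_norm_less[OF h norm_dilate[OF rad_bounds that]] by (rule less_imp_le)
    have m: "(\<lambda>w. ?h n (boundary_map f w)) \<in> borel_measurable ?M" for n
      by (rule measurable_compose[OF T measurable_dilate[OF inner_holomorphic[OF h] rad_bounds]])
    have 1: "(\<integral>w. ?h n (boundary_map f w) * of_real (poisson z w) \<partial>?M) = ?h n (f z)" for n
    proof (rule poisson_integral_radial_limit[OF _ _ m _ z, where C=1])
      show "(\<lambda>w. ?h n (f w)) holomorphic_on ball 0 1"
        by (rule holomorphic_on_compose_gen[unfolded o_def, OF inner_holomorphic[OF f(1)] hol])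
           (use inner_norm_less[OF f(1)] in auto)
      show "norm (?h n (f w)) \<le> 1" if "norm w < 1" for w
        using inner_norm_less[OF f(1) that] by (intro bd) simp
      show "AE w in ?M. has_radial_limit (\<lambda>w. ?h n (f w)) w (?h n (boundary_map f w))"
        using AE_radial_limit[OF f(1)]
      proof eventually_elim
        fix w assume w: "has_radial_limit f w (boundary_map f w)"
        have "isCont h (of_real (rad n) * boundary_map f w)"
          using inner_holomorphic[OF h] norm_dilate[OF rad_bounds, of "boundary_map f w" n]
          by (intro continuous_on_interior[OF holomorphic_on_imp_continuous_on]) (auto simp: interior_open)
        then show "has_radial_limit (\<lambda>w. ?h n (f w)) w (?h n (boundary_map f w))"
          using w unfolding has_radial_limit_def
          by (intro isCont_tendsto_compose[of _ h] tendsto_intros)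
      qed
    qed
    have "(\<lambda>n. \<integral>w. ?h n (boundary_map f w) * of_real (poisson z w) \<partial>?M) \<longlonglongrightarrow> (\<integral>w. \<phi> w * of_real (poisson z w) \<partial>?M)"
    proof (rule integral_dominated_convergence[where w="\<lambda>_. 1 * (2 / (1 - norm z))"])
      show "AE w in ?M. (\<lambda>n. ?h n (boundary_map f w) * of_real (poisson z w)) \<longlonglongrightarrow> \<phi> w * of_real (poisson z w)"
        using AE_boundary_comp[OF f AE_radial_limit[OF h]]
      proof eventually_elim
        fix w assume "has_radial_limit h (boundary_map f w) (boundary_map h (boundary_map f w))"
        from radial_limit_rad[OF this] show "(\<lambda>n. ?h n (boundary_map f w) * of_real (poisson z w)) \<longlonglongrightarrow> \<phi> w * of_real (poisson z w)"
          unfolding \<phi>_def by (intro tendsto_intros)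
      qed
      show "AE w in ?M. norm (?h n (boundary_map f w) * of_real (poisson z w)) \<le> 1 * (2 / (1 - norm z))" for n
      proof (rule AE_I2)
        fix w assume "w \<in> space ?M"
        then have w: "norm w = 1" by simp
        show "norm (?h n (boundary_map f w) * of_real (poisson z w)) \<le> 1 * (2 / (1 - norm z))"
          unfolding norm_mult using poisson_le[OF w z] poisson_nonneg[of z w] z bd[of "boundary_map f w" n]
          by (intro mult_mono) auto
      qed
    qed (use \<phi>m m in measurable)
    then have "(\<lambda>n. ?h n (f z)) \<longlonglongrightarrow> (\<integral>w. \<phi> w * of_real (poisson z w) \<partial>?M)" unfolding 1 .
    moreover have "(\<lambda>n. ?h n (f z)) \<longlonglongrightarrow> h (f z)"
      by (rule tendsto_dilate[OF inner_holomorphic[OF h] inner_norm_less[OF f(1) z]])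
    ultimately show ?thesis by (rule LIMSEQ_unique)
  qed
  have n1: "norm (\<phi> w) = 1" for w by (simp add: \<phi>_def)
  have "AE \<zeta> in ?M. ((\<lambda>r. \<integral>w. \<phi> w * of_real (poisson (of_real r * \<zeta>) w) \<partial>?M) \<longlongrightarrow> \<phi> \<zeta>) (at_left 1) \<and> \<zeta> \<in> space ?M"
    by (intro AE_conjI AE_space fatou_poisson[OF \<phi>m, of 1]) (simp add: n1)
  then have rl: "AE \<zeta> in ?M. has_radial_limit (h \<circ> f) \<zeta> (\<phi> \<zeta>)"
  proof eventually_elim
    fix \<zeta> assume a: "((\<lambda>r. \<integral>w. \<phi> w * of_real (poisson (of_real r * \<zeta>) w) \<partial>?M) \<longlongrightarrow> \<phi> \<zeta>) (at_left 1) \<and> \<zeta> \<in> space ?M"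
    have "\<forall>\<^sub>F r in at_left (1::real). 0 < r \<and> r < 1"
      using eventually_at_left_real[of 0 "1::real"] by (auto elim: eventually_mono)
    then have "\<forall>\<^sub>F r in at_left 1. (\<integral>w. \<phi> w * of_real (poisson (of_real r * \<zeta>) w) \<partial>?M) = (h \<circ> f) (of_real r * \<zeta>)"
    proof eventually_elim
      fix r :: real assume "0 < r \<and> r < 1"
      then have "norm (of_real r * \<zeta>) < 1" using a norm_dilate[of r \<zeta>] by simp
      from rep[OF this] show "(\<integral>w. \<phi> w * of_real (poisson (of_real r * \<zeta>) w) \<partial>?M) = (h \<circ> f) (of_real r * \<zeta>)"
        by simp
    qed
    then show "has_radial_limit (h \<circ> f) \<zeta> (\<phi> \<zeta>)"
      unfolding has_radial_limit_def using a tendsto_cong by fast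
  qed
  have "AE z in ?M. \<exists>w. has_radial_limit (h \<circ> f) z w \<and> norm w = 1"
    using rl by eventually_elim (use n1 in blast)
  then show "inner_function (h \<circ> f)"
    unfolding inner_function_def using holo inner_norm_less[OF f(1)] inner_norm_less[OF h] by auto
  show "AE z in ?M. boundary_map (h \<circ> f) z = boundary_map h (boundary_map f z)"
    using rl by eventually_elim (use n1 in \<open>simp add: boundary_map_eqI \<phi>_def\<close>)
qed

text \<open>Schwarz's lemma gives \<open>h z = z * q z\<close> with \<open>q\<close> bounded by one
  and \<open>q 0 = deriv h 0\<close>. On the circle \<open>cnj z\<close> is the inverse of
  \<open>z\<close>, so the integrand is the radial limit of \<open>q z ^ k\<close>, whose mean is
  \<open>q 0 ^ k\<close>.\<close>

lemma fourier_coefficient_boundary: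
  assumes h: "inner_function h" "h 0 = 0"
  shows "(\<integral>z. (boundary_map h z) ^ k * cnj (z ^ k) \<partial>circle_measure) = (deriv h 0) ^ k"
proof -
  obtain q where q: "q holomorphic_on ball 0 1" "\<And>z. norm z < 1 \<Longrightarrow> h z = z * q z" "deriv h 0 = q 0"
    using Schwarz3[OF inner_holomorphic[OF h(1)] h(2)] by blast
  have q1: "norm (q z) \<le> 1" if z: "norm z < 1" for z
  proof (cases "z = 0")
    case True
    then show ?thesis
      using Schwarz_Lemma(2)[OF inner_holomorphic[OF h(1)] h(2) inner_norm_less[OF h(1)] z] q(3) by simp
  next
    case False
    then show ?thesis
      using Schwarz_Lemma(1)[OF inner_holomorphic[OF h(1)] h(2) inner_norm_less[OF h(1)] z] q(2)[OF z]
      by (simp add: norm_mult)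
  qed
  have m: "(\<lambda>z. (boundary_map h z) ^ k * cnj (z ^ k)) \<in> borel_measurable circle_measure"
  proof -
    have "(\<lambda>z. cnj (z ^ k)) \<in> borel_measurable circle_measure"
      by (rule borel_measurable_circle_continuous) (intro continuous_intros)
    then show ?thesis using h by measurable
  qed
  have "(\<integral>z. (boundary_map h z) ^ k * cnj (z ^ k) \<partial>circle_measure) = (q 0) ^ k"
  proof (rule integral_radial_limit[OF _ _ m, where F="\<lambda>z. q z ^ k" and C=1])
    show "(\<lambda>z. q z ^ k) holomorphic_on ball 0 1" by (intro holomorphic_intros q)
    show "norm (q z ^ k) \<le> 1" if "norm z < 1" for z
      using q1[OF that] by (simp add: norm_power power_le_one)
    have "AE z in circle_measure. has_radial_limit h z (boundary_map h z) \<and> z \<in> space circle_measure"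
      by (intro AE_conjI AE_space AE_radial_limit h)
    then show "AE z in circle_measure. has_radial_limit (\<lambda>z. q z ^ k) z ((boundary_map h z) ^ k * cnj (z ^ k))"
    proof eventually_elim
      fix z assume z: "has_radial_limit h z (boundary_map h z) \<and> z \<in> space circle_measure"
      then have zz: "z * cnj z = 1" "z \<noteq> 0" by (auto simp: complex_norm_square[symmetric])
      have "((\<lambda>r. (h (of_real r * z) / (of_real r * z)) ^ k) \<longlongrightarrow> (boundary_map h z / (of_real 1 * z)) ^ k) (at_left 1)"
        using z zz unfolding has_radial_limit_def by (intro tendsto_intros) auto
      moreover have "\<forall>\<^sub>F r in at_left (1::real). 0 < r \<and> r < 1"
        using eventually_at_left_real[of 0 "1::real"] by (auto elim: eventually_mono)
      then have "\<forall>\<^sub>F r in at_left 1. (h (of_real r * z) / (of_real r * z)) ^ k = q (of_real r * z) ^ k"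
      proof eventually_elim
        fix r :: real assume r: "0 < r \<and> r < 1"
        then have "norm (of_real r * z) < 1" using z norm_dilate[of r z] by simp
        from q(2)[OF this] show "(h (of_real r * z) / (of_real r * z)) ^ k = q (of_real r * z) ^ k"
          using r zz by simp
      qed
      ultimately have "((\<lambda>r. q (of_real r * z) ^ k) \<longlongrightarrow> (boundary_map h z / (of_real 1 * z)) ^ k) (at_left 1)"
        using tendsto_cong by fast
      moreover have "(boundary_map h z / (of_real 1 * z)) ^ k = (boundary_map h z) ^ k * cnj (z ^ k)"
      proof -
        have "boundary_map h z / (of_real 1 * z) = boundary_map h z * cnj z"
          using zz by (simp add: field_simps)
        then show ?thesis by (simp add: power_mult_distrib)
      qed
      ultimately show "has_radial_limit (\<lambda>z. q z ^ k) z ((boundary_map h z) ^ k * cnj (z ^ k))"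
        unfolding has_radial_limit_def by simp
    qed
  qed
  then show ?thesis using q(3) by simp
qed

section \<open>Averages along measure-preserving sequences\<close>

lemma norm_add_square_le:
  fixes a b :: complex
  shows "(norm (a + b))\<^sup>2 \<le> 2 * (norm a)\<^sup>2 + 2 * (norm b)\<^sup>2"
proof -
  have "(norm (a + b))\<^sup>2 \<le> (norm a + norm b)\<^sup>2" by (intro power_mono norm_triangle_ineq) auto
  also have "\<dots> \<le> 2 * (norm a)\<^sup>2 + 2 * (norm b)\<^sup>2"
    using zero_le_power2[of "norm a - norm b"] by (simp add: power2_eq_square algebra_simps)
  finally show ?thesis .
qed

lemma square_integrable_add:
  assumes "square_integrable M f" "square_integrable M g"
  shows "square_integrable M (\<lambda>x. f x + g x)"
  unfolding square_integrable_def
proof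
  have [measurable]: "f \<in> borel_measurable M" "g \<in> borel_measurable M"
    using assms by (auto simp: square_integrable_def)
  show "(\<lambda>x. f x + g x) \<in> borel_measurable M" by measurable
  show "integrable M (\<lambda>x. (norm (f x + g x))\<^sup>2)"
  proof (rule Bochner_Integration.integrable_bound)
    show "integrable M (\<lambda>x. 2 * (norm (f x))\<^sup>2 + 2 * (norm (g x))\<^sup>2)"
      using assms by (auto simp: square_integrable_def)
    show "AE x in M. norm ((norm (f x + g x))\<^sup>2) \<le> norm (2 * (norm (f x))\<^sup>2 + 2 * (norm (g x))\<^sup>2)"
      using norm_add_square_le by (intro AE_I2) (simp add: add_nonneg_nonneg)
  qed measurable
qed

lemma square_integrable_mult:
  assumes "square_integrable M f"
  shows "square_integrable M (\<lambda>x. c * f x)"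
  using assms by (auto simp: square_integrable_def norm_mult power_mult_distrib)

lemma square_integrable_sum:
  assumes "\<And>i. i \<in> I \<Longrightarrow> square_integrable M (f i)"
  shows "square_integrable M (\<lambda>x. \<Sum>i\<in>I. f i x)"
  using assms
proof (induction I rule: infinite_finite_induct)
  case (insert i I)
  then show ?case by (simp add: square_integrable_add)
qed (auto simp: square_integrable_def)

lemma (in finite_measure) square_integrable_const: "square_integrable M (\<lambda>_. c)"
  by (simp add: square_integrable_def)

lemma (in finite_measure) square_integrable_bounded:
  assumes "f \<in> borel_measurable M" "\<And>x. x \<in> space M \<Longrightarrow> norm (f x) \<le> C"
  shows "square_integrable M f"
  unfolding square_integrable_def
proof
  show "integrable M (\<lambda>x. (norm (f x))\<^sup>2)"
    by (rule integrable_const_bound[of _ "C\<^sup>2"])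
       (use assms in \<open>auto intro!: AE_I2 power_mono\<close>)
qed fact

lemma (in finite_measure) integrable_if_square_integrable:
  assumes "square_integrable M f"
  shows "integrable M f"
proof (rule Bochner_Integration.integrable_bound)
  show "integrable M (\<lambda>x. 1 + (norm (f x))\<^sup>2)" using assms by (auto simp: square_integrable_def)
  show "AE x in M. norm (f x) \<le> norm (1 + (norm (f x))\<^sup>2)"
  proof (rule AE_I2)
    fix x
    have "norm (f x) \<le> 1 + (norm (f x))\<^sup>2"
      using zero_le_power2[of "norm (f x) - 1/2"] by (simp add: power2_eq_square algebra_simps)
    then show "norm (f x) \<le> norm (1 + (norm (f x))\<^sup>2)" by simp
  qed
qed (use assms in \<open>auto simp: square_integrable_def\<close>)

text \<open>The variance of \<open>norm (f x)\<close> is nonnegative.\<close>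

lemma (in prob_space) norm_integral_square_le:
  assumes "square_integrable M f"
  shows "(norm (\<integral>x. f x \<partial>M))\<^sup>2 \<le> (\<integral>x. (norm (f x))\<^sup>2 \<partial>M)"
proof -
  have i: "integrable M f" by (rule integrable_if_square_integrable[OF assms])
  have i2: "integrable M (\<lambda>x. (norm (f x))\<^sup>2)" using assms by (simp add: square_integrable_def)
  define a where "a = (\<integral>x. norm (f x) \<partial>M)"
  have a: "norm (\<integral>x. f x \<partial>M) \<le> a" unfolding a_def by (rule integral_norm_bound)
  have "0 \<le> (\<integral>x. (norm (f x) - a)\<^sup>2 \<partial>M)" by simp
  also have "\<dots> = (\<integral>x. (norm (f x))\<^sup>2 - 2 * a * norm (f x) + a\<^sup>2 \<partial>M)"
    by (simp add: power2_eq_square algebra_simps)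
  also have "\<dots> = (\<integral>x. (norm (f x))\<^sup>2 \<partial>M) - 2 * a * a + a\<^sup>2"
    using i i2 by (simp add: a_def prob_space)
  finally have "a\<^sup>2 \<le> (\<integral>x. (norm (f x))\<^sup>2 \<partial>M)" by (simp add: power2_eq_square)
  moreover have "(norm (\<integral>x. f x \<partial>M))\<^sup>2 \<le> a\<^sup>2" using a by (intro power_mono) auto
  ultimately show ?thesis by simp
qed

lemma norm_average_square_le:
  fixes a :: "nat \<Rightarrow> complex"
  shows "(norm ((\<Sum>n=1..N. a n) / of_nat N))\<^sup>2 \<le> (\<Sum>n=1..N. (norm (a n))\<^sup>2) / real N"
proof (cases "N = 0")
  case False
  have "(norm (\<Sum>n=1..N. a n))\<^sup>2 \<le> (\<Sum>n=1..N. 1 * norm (a n))\<^sup>2"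
    by (intro power_mono) (auto intro: norm_sum)
  also have "\<dots> \<le> (\<Sum>n=1..N. 1\<^sup>2) * (\<Sum>n=1..N. (norm (a n))\<^sup>2)"
    by (rule Cauchy_Schwarz_ineq_sum)
  finally show ?thesis using False
    by (simp add: norm_divide power_divide power2_eq_square field_simps)
qed simp

locale mp_sequence = prob_space M for M :: "'a measure" +
  fixes T :: "nat \<Rightarrow> 'a \<Rightarrow> 'a"
  assumes mp: "\<And>n. n \<ge> 1 \<Longrightarrow> measure_preserving_map M (T n)"
begin

lemma T_measurable: "n \<ge> 1 \<Longrightarrow> T n \<in> M \<rightarrow>\<^sub>M M"
  using mp by (simp add: measure_preserving_map_def)

lemma integral_T:
  fixes f :: "'a \<Rightarrow> 'b::{banach, second_countable_topology}"
  assumes "n \<ge> 1" "f \<in> borel_measurable M"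
  shows "(\<integral>x. f (T n x) \<partial>M) = (\<integral>x. f x \<partial>M)"
  using integral_distr[OF T_measurable[OF assms(1)] assms(2)] mp[OF assms(1)]
  by (simp add: measure_preserving_map_def)

lemma integrable_T:
  fixes f :: "'a \<Rightarrow> 'b::{banach, second_countable_topology}"
  assumes "n \<ge> 1" "integrable M f"
  shows "integrable M (\<lambda>x. f (T n x))"
  using integrable_distr[OF T_measurable[OF assms(1)], of f] mp[OF assms(1)] assms(2)
  by (simp add: measure_preserving_map_def)

lemma square_integrable_T:
  assumes "n \<ge> 1" "square_integrable M f"
  shows "square_integrable M (\<lambda>x. f (T n x))"
  using assms measurable_compose[OF T_measurable[OF assms(1)], of f borel]
    integrable_T[OF assms(1), of "\<lambda>x. (norm (f x))\<^sup>2"]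
  by (auto simp: square_integrable_def)

definition deviation :: "('a \<Rightarrow> complex) \<Rightarrow> nat \<Rightarrow> 'a \<Rightarrow> complex" where
  "deviation \<phi> N x = (\<Sum>n=1..N. \<phi> (T n x)) / of_nat N - (\<integral>y. \<phi> y \<partial>M)"

text \<open>Squared norms keep the estimates free of roots, and including square integrability lets
  the closure rules below be chained without side conditions.\<close>

definition averaging :: "('a \<Rightarrow> complex) \<Rightarrow> bool" where
  "averaging \<phi> \<longleftrightarrow> square_integrable M \<phi> \<and> (\<lambda>N. \<integral>x. (norm (deviation \<phi> N x))\<^sup>2 \<partial>M) \<longlonglongrightarrow> 0"

lemma square_integrable_average:
  assumes "square_integrable M \<phi>"
  shows "square_integrable M (\<lambda>x. (\<Sum>n=1..N. \<phi> (T n x)) / of_nat N)"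
proof -
  have "square_integrable M (\<lambda>x. inverse (of_nat N) * (\<Sum>n=1..N. \<phi> (T n x)))"
    by (intro square_integrable_mult square_integrable_sum square_integrable_T assms) auto
  then show ?thesis by (simp add: field_simps)
qed

lemma square_integrable_deviation:
  assumes "square_integrable M \<phi>"
  shows "square_integrable M (deviation \<phi> N)"
  using square_integrable_add[OF square_integrable_average[OF assms] square_integrable_const[of "- (\<integral>y. \<phi> y \<partial>M)"]]
  by (simp add: deviation_def[abs_def])

text \<open>Each \<open>\<phi> (T n x)\<close> has the same mean square as \<open>\<phi>\<close>, so
  by convexity the average has no larger one; the mean contributes as much again, and
  \<open>norm_add_square_le\<close> doubles both. Uniformity in \<open>N\<close> is what makes
  approximation possible.\<close>

lemma deviation_le:
  assumes \<phi>: "square_integrable M \<phi>"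
  shows "(\<integral>x. (norm (deviation \<phi> N x))\<^sup>2 \<partial>M) \<le> 4 * (\<integral>x. (norm (\<phi> x))\<^sup>2 \<partial>M)"
proof -
  let ?Q = "\<integral>x. (norm (\<phi> x))\<^sup>2 \<partial>M" and ?A = "\<lambda>x. (\<Sum>n=1..N. \<phi> (T n x)) / of_nat N"
  have i: "integrable M (\<lambda>x. (norm (\<phi> x))\<^sup>2)" using \<phi> by (simp add: square_integrable_def)
  have iA: "integrable M (\<lambda>x. (norm (?A x))\<^sup>2)"
    using square_integrable_average[OF \<phi>] by (simp add: square_integrable_def)
  have iS: "integrable M (\<lambda>x. (\<Sum>n=1..N. (norm (\<phi> (T n x)))\<^sup>2) / real N)"
    by (intro integrable_divide Bochner_Integration.integrable_sum) (use integrable_T[OF _ i] in auto)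
  have "(\<integral>x. (norm (?A x))\<^sup>2 \<partial>M) \<le> (\<integral>x. (\<Sum>n=1..N. (norm (\<phi> (T n x)))\<^sup>2) / real N \<partial>M)"
    by (rule integral_mono[OF iA iS]) (rule norm_average_square_le)
  also have "\<dots> = (\<Sum>n=1..N. \<integral>x. (norm (\<phi> (T n x)))\<^sup>2 \<partial>M) / real N"
    using integrable_T[OF _ i] by (simp add: Bochner_Integration.integral_sum)
  also have "(\<Sum>n=1..N. \<integral>x. (norm (\<phi> (T n x)))\<^sup>2 \<partial>M) = (\<Sum>n=1..N. ?Q)"
    using \<phi> by (intro sum.cong integral_T) (auto simp: square_integrable_def)
  also have "\<dots> / real N \<le> ?Q" by (cases "N = 0") auto
  finally have A: "(\<integral>x. (norm (?A x))\<^sup>2 \<partial>M) \<le> ?Q" .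
  have "(\<integral>x. (norm (deviation \<phi> N x))\<^sup>2 \<partial>M) \<le> (\<integral>x. 2 * (norm (?A x))\<^sup>2 + 2 * (norm (\<integral>y. \<phi> y \<partial>M))\<^sup>2 \<partial>M)"
  proof (rule integral_mono)
    show "integrable M (\<lambda>x. (norm (deviation \<phi> N x))\<^sup>2)"
      using square_integrable_deviation[OF \<phi>] by (simp add: square_integrable_def)
    show "integrable M (\<lambda>x. 2 * (norm (?A x))\<^sup>2 + 2 * (norm (\<integral>y. \<phi> y \<partial>M))\<^sup>2)"
      using iA by simp
    show "(norm (deviation \<phi> N x))\<^sup>2 \<le> 2 * (norm (?A x))\<^sup>2 + 2 * (norm (\<integral>y. \<phi> y \<partial>M))\<^sup>2" for x
      using norm_add_square_le[of "?A x" "- (\<integral>y. \<phi> y \<partial>M)"] by (simp add: deviation_def)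
  qed
  also have "\<dots> = 2 * (\<integral>x. (norm (?A x))\<^sup>2 \<partial>M) + 2 * (norm (\<integral>y. \<phi> y \<partial>M))\<^sup>2"
    using iA by (simp add: prob_space)
  also have "\<dots> \<le> 4 * ?Q" using A norm_integral_square_le[OF \<phi>] by simp
  finally show ?thesis .
qed

lemma deviation_add:
  assumes "integrable M \<phi>" "integrable M \<psi>"
  shows "deviation (\<lambda>x. \<phi> x + \<psi> x) N x = deviation \<phi> N x + deviation \<psi> N x"
  using assms by (simp add: deviation_def sum.distrib add_divide_distrib)

lemma deviation_square_add_le:
  assumes \<phi>: "square_integrable M \<phi>" and \<psi>: "square_integrable M \<psi>"
  shows "(\<integral>x. (norm (deviation (\<lambda>x. \<phi> x + \<psi> x) N x))\<^sup>2 \<partial>M)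
    \<le> 2 * (\<integral>x. (norm (deviation \<phi> N x))\<^sup>2 \<partial>M) + 2 * (\<integral>x. (norm (deviation \<psi> N x))\<^sup>2 \<partial>M)"
proof -
  have i: "integrable M (\<lambda>x. (norm (deviation \<phi> N x))\<^sup>2)" "integrable M (\<lambda>x. (norm (deviation \<psi> N x))\<^sup>2)"
    "integrable M (\<lambda>x. (norm (deviation (\<lambda>x. \<phi> x + \<psi> x) N x))\<^sup>2)"
    using square_integrable_deviation[OF \<phi>] square_integrable_deviation[OF \<psi>]
      square_integrable_deviation[OF square_integrable_add[OF \<phi> \<psi>]] by (auto simp: square_integrable_def)
  have "(\<integral>x. (norm (deviation (\<lambda>x. \<phi> x + \<psi> x) N x))\<^sup>2 \<partial>M)
    \<le> (\<integral>x. 2 * (norm (deviation \<phi> N x))\<^sup>2 + 2 * (norm (deviation \<psi> N x))\<^sup>2 \<partial>M)"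
    using norm_add_square_le integrable_if_square_integrable \<phi> \<psi>
    by (intro integral_mono) (use i in \<open>auto simp: deviation_add\<close>)
  then show ?thesis using i by simp
qed

lemma averaging_add:
  assumes "averaging \<phi>" "averaging \<psi>"
  shows "averaging (\<lambda>x. \<phi> x + \<psi> x)"
  unfolding averaging_def
proof
  show "square_integrable M (\<lambda>x. \<phi> x + \<psi> x)"
    using assms by (auto simp: averaging_def intro: square_integrable_add)
  have lim: "(\<lambda>N. 2 * (\<integral>x. (norm (deviation \<phi> N x))\<^sup>2 \<partial>M) + 2 * (\<integral>x. (norm (deviation \<psi> N x))\<^sup>2 \<partial>M)) \<longlonglongrightarrow> 0"
    using assms unfolding averaging_def by (intro tendsto_add_zero tendsto_mult_right_zero) auto
  show "(\<lambda>N. \<integral>x. (norm (deviation (\<lambda>x. \<phi> x + \<psi> x) N x))\<^sup>2 \<partial>M) \<longlonglongrightarrow> 0"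
  proof (rule tendsto_sandwich[OF _ _ tendsto_const lim])
    show "\<forall>\<^sub>F N in sequentially. (\<integral>x. (norm (deviation (\<lambda>x. \<phi> x + \<psi> x) N x))\<^sup>2 \<partial>M)
      \<le> 2 * (\<integral>x. (norm (deviation \<phi> N x))\<^sup>2 \<partial>M) + 2 * (\<integral>x. (norm (deviation \<psi> N x))\<^sup>2 \<partial>M)"
      using assms unfolding averaging_def by (intro always_eventually allI deviation_square_add_le) auto
  qed simp
qed

lemma averaging_mult:
  assumes "averaging \<phi>"
  shows "averaging (\<lambda>x. c * \<phi> x)"
proof -
  have "deviation (\<lambda>x. c * \<phi> x) N x = c * deviation \<phi> N x" for N x
    by (simp add: deviation_def right_diff_distrib sum_distrib_left)
  moreover have "(\<lambda>N. (norm c)\<^sup>2 * (\<integral>x. (norm (deviation \<phi> N x))\<^sup>2 \<partial>M)) \<longlonglongrightarrow> (norm c)\<^sup>2 * 0"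
    using assms by (intro tendsto_intros) (auto simp: averaging_def)
  ultimately show ?thesis
    using assms by (simp add: averaging_def square_integrable_mult norm_mult power_mult_distrib)
qed

lemma averaging_const: "averaging (\<lambda>_. c)"
  unfolding averaging_def
proof (intro conjI square_integrable_const)
  \<comment> \<open>For \<open>N = 0\<close> the quotient is \<open>0\<close>, so the deviation
    would be \<open>- c\<close>.\<close>
  have "deviation (\<lambda>_. c) N x = 0" if "N \<ge> 1" for N x
    using that by (simp add: deviation_def prob_space)
  then show "(\<lambda>N. \<integral>x. (norm (deviation (\<lambda>_. c) N x))\<^sup>2 \<partial>M) \<longlonglongrightarrow> 0"
    by (intro tendsto_eventually eventually_sequentiallyI[of 1]) simp
qed

lemma averaging_sum:
  assumes "\<And>i. i \<in> I \<Longrightarrow> averaging (f i)"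
  shows "averaging (\<lambda>x. \<Sum>i\<in>I. f i x)"
  using assms
proof (induction I rule: infinite_finite_induct)
  case (insert i I)
  then show ?case by (simp add: averaging_add)
qed (auto intro: averaging_const)

lemma averaging_cnj:
  assumes "averaging \<phi>"
  shows "averaging (\<lambda>x. cnj (\<phi> x))"
proof -
  have "deviation (\<lambda>x. cnj (\<phi> x)) N x = cnj (deviation \<phi> N x)" for N x
    by (simp add: deviation_def)
  moreover have "square_integrable M (\<lambda>x. cnj (\<phi> x))"
  proof -
    have [measurable]: "cnj \<in> borel_measurable borel"
      by (intro borel_measurable_continuous_onI continuous_intros)
    have "\<phi> \<in> borel_measurable M" using assms by (simp add: averaging_def square_integrable_def)
    then have "(\<lambda>x. cnj (\<phi> x)) \<in> borel_measurable M" by measurable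
    then show ?thesis using assms by (simp add: averaging_def square_integrable_def)
  qed
  ultimately show ?thesis using assms by (simp add: averaging_def)
qed

lemma averaging_approx:
  assumes \<phi>: "square_integrable M \<phi>"
    and approx: "\<And>e. e > 0 \<Longrightarrow> \<exists>\<psi>. averaging \<psi> \<and> (\<integral>x. (norm (\<phi> x - \<psi> x))\<^sup>2 \<partial>M) \<le> e"
  shows "averaging \<phi>"
  unfolding averaging_def
proof
  show "(\<lambda>N. \<integral>x. (norm (deviation \<phi> N x))\<^sup>2 \<partial>M) \<longlonglongrightarrow> 0"
  proof (rule tendstoI)
    fix e :: real assume e: "e > 0"
    \<comment> \<open>The error enters with the factor \<open>2\<close> of
      \<open>deviation_square_add_le\<close> and the factor \<open>4\<close> of
      \<open>deviation_le\<close>, so \<open>e / 16\<close> contributes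
      \<open>e / 2\<close>.\<close>
    obtain \<psi> where \<psi>: "averaging \<psi>" "(\<integral>x. (norm (\<phi> x - \<psi> x))\<^sup>2 \<partial>M) \<le> e / 16"
      using approx[of "e/16"] e by auto
    have s: "square_integrable M \<psi>" using \<psi> by (simp add: averaging_def)
    have d: "square_integrable M (\<lambda>x. \<phi> x - \<psi> x)"
      using square_integrable_add[OF \<phi> square_integrable_mult[OF s, of "-1"]] by simp
    have "\<forall>\<^sub>F N in sequentially. dist (\<integral>x. (norm (deviation \<psi> N x))\<^sup>2 \<partial>M) 0 < e / 4"
      using \<psi>(1) e unfolding averaging_def by (intro tendstoD) auto
    then show "\<forall>\<^sub>F N in sequentially. dist (\<integral>x. (norm (deviation \<phi> N x))\<^sup>2 \<partial>M) 0 < e"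
    proof eventually_elim
      fix N assume N: "dist (\<integral>x. (norm (deviation \<psi> N x))\<^sup>2 \<partial>M) 0 < e / 4"
      have "(\<integral>x. (norm (deviation \<phi> N x))\<^sup>2 \<partial>M)
        \<le> 2 * (\<integral>x. (norm (deviation \<psi> N x))\<^sup>2 \<partial>M) + 2 * (\<integral>x. (norm (deviation (\<lambda>x. \<phi> x - \<psi> x) N x))\<^sup>2 \<partial>M)"
        using deviation_square_add_le[OF s d, of N] by simp
      also have "\<dots> < e"
        using N deviation_le[OF d, of N] \<psi>(2) by simp
      finally show "dist (\<integral>x. (norm (deviation \<phi> N x))\<^sup>2 \<partial>M) 0 < e" by simp
    qed
  qed
qed fact

lemma averaging_limit:
  assumes \<phi>: "square_integrable M \<phi>" and \<psi>: "\<And>n. averaging (\<psi> n)"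
    and lim: "(\<lambda>n. \<integral>x. (norm (\<phi> x - \<psi> n x))\<^sup>2 \<partial>M) \<longlonglongrightarrow> 0"
  shows "averaging \<phi>"
proof (rule averaging_approx[OF \<phi>])
  fix e :: real assume "e > 0"
  then have "\<forall>\<^sub>F n in sequentially. (\<integral>x. (norm (\<phi> x - \<psi> n x))\<^sup>2 \<partial>M) < e"
    using lim by (intro order_tendstoD(2))
  then obtain n where "(\<integral>x. (norm (\<phi> x - \<psi> n x))\<^sup>2 \<partial>M) < e"
    by (auto simp: eventually_sequentially)
  then show "\<exists>\<psi>. averaging \<psi> \<and> (\<integral>x. (norm (\<phi> x - \<psi> x))\<^sup>2 \<partial>M) \<le> e"
    using \<psi> by (intro exI[of _ "\<psi> n"]) simp
qed

lemma ergodic_iff_averaging: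
  "ergodic_sequence M T \<longleftrightarrow> (\<forall>\<phi>. square_integrable M \<phi> \<longrightarrow> averaging \<phi>)"
proof -
  have "(\<lambda>N. norm_L2 M (\<lambda>x. (\<Sum>n=1..N. \<phi> (T n x)) / of_nat N - (\<integral>y. \<phi> y \<partial>M))) \<longlonglongrightarrow> 0
    \<longleftrightarrow> (\<lambda>N. \<integral>x. (norm (deviation \<phi> N x))\<^sup>2 \<partial>M) \<longlonglongrightarrow> 0" (is "?L \<longleftrightarrow> ?R") for \<phi>
  proof -
    have e: "norm_L2 M (\<lambda>x. (\<Sum>n=1..N. \<phi> (T n x)) / of_nat N - (\<integral>y. \<phi> y \<partial>M)) = sqrt (\<integral>x. (norm (deviation \<phi> N x))\<^sup>2 \<partial>M)" for N
      by (simp add: norm_L2_def deviation_def)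
    show ?thesis unfolding e
    proof
      assume "(\<lambda>N. sqrt (\<integral>x. (norm (deviation \<phi> N x))\<^sup>2 \<partial>M)) \<longlonglongrightarrow> 0"
      from tendsto_power[OF this, of 2] show ?R by simp
    next
      assume ?R
      from tendsto_real_sqrt[OF this] show "(\<lambda>N. sqrt (\<integral>x. (norm (deviation \<phi> N x))\<^sup>2 \<partial>M)) \<longlonglongrightarrow> 0" by simp
    qed
  qed
  then show ?thesis
    unfolding ergodic_sequence_def averaging_def using mp by blast
qed

end

section \<open>Density of trigonometric polynomials\<close>

text \<open>With \<open>u = cnj z * w\<close> the kernel is the real part of
  \<open>(1 + u) / (1 - u)\<close>, that is, of one plus twice a geometric series; the right-hand
  side bounds its tail.\<close>

lemma poisson_geometric:
  assumes z: "norm z < 1" and w: "norm w = 1"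
  shows "\<bar>poisson z w - Re (1 + 2 * (\<Sum>k=1..K. (cnj z * w) ^ k))\<bar> \<le> 2 * norm z ^ Suc K / (1 - norm z)"
proof -
  define u where "u = cnj z * w"
  have nu: "norm u = norm z" using w by (simp add: u_def norm_mult)
  have nz: "1 - u \<noteq> 0" using norm_cnj_mult_le_and_nonzero(2)[OF z, of w] w by (simp add: u_def)
  have g: "(1 - u) * (1 + 2 * (\<Sum>k=1..K. u ^ k)) = 1 + u - 2 * u ^ Suc K"
  proof (induction K)
    case (Suc K)
    have "(1 - u) * (1 + 2 * (\<Sum>k=1..Suc K. u ^ k)) = (1 - u) * (1 + 2 * (\<Sum>k=1..K. u ^ k)) + 2 * (1 - u) * u ^ Suc K"
      by (simp add: distrib_left)
    also have "\<dots> = 1 + u - 2 * u ^ Suc (Suc K)"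
      unfolding Suc.IH by (simp add: algebra_simps)
    finally show ?case .
  qed simp
  have "(1 + u) / (1 - u) - (1 + 2 * (\<Sum>k=1..K. u ^ k)) = 2 * u ^ Suc K / (1 - u)"
  proof -
    define S where "S = 1 + 2 * (\<Sum>k=1..K. u ^ k)"
    have "(1 + u) / (1 - u) - S = (1 + u - (1 - u) * S) / (1 - u)"
      using nz by (simp add: diff_divide_distrib)
    also have "\<dots> = 2 * u ^ Suc K / (1 - u)"
      using g unfolding S_def[symmetric] by simp
    finally show ?thesis unfolding S_def .
  qed
  then have "poisson z w - Re (1 + 2 * (\<Sum>k=1..K. u ^ k)) = Re (2 * u ^ Suc K / (1 - u))"
    using poisson_eq_Re[OF z w] unfolding u_def[symmetric] by (metis minus_complex.sel(1))
  also have "\<bar>\<dots>\<bar> \<le> norm (2 * u ^ Suc K / (1 - u))" by (rule abs_Re_le_cmod)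
  also have "\<dots> = 2 * norm z ^ Suc K / norm (1 - u)"
    by (simp add: norm_divide norm_mult norm_power nu)
  also have "\<dots> \<le> 2 * norm z ^ Suc K / (1 - norm z)"
    using norm_triangle_ineq2[of 1 u] nu z
    by (intro divide_left_mono mult_pos_pos) (auto intro: less_le_trans)
  finally show ?thesis by (simp add: u_def)
qed

definition poisson_int :: "(complex \<Rightarrow> complex) \<Rightarrow> real \<Rightarrow> complex \<Rightarrow> complex" where
  "poisson_int \<phi> r \<zeta> = (\<integral>w. \<phi> w * of_real (poisson (of_real r * \<zeta>) w) \<partial>circle_measure)"

lemma norm_poisson_int_le:
  assumes \<phi>: "\<phi> \<in> borel_measurable circle_measure" "\<And>w. norm w = 1 \<Longrightarrow> norm (\<phi> w) \<le> C"
    and r: "0 < r" "r < 1" and \<zeta>: "norm \<zeta> \<le> 1"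
  shows "norm (poisson_int \<phi> r \<zeta>) \<le> C"
proof -
  note z = norm_dilate[OF r \<zeta>]
  have ip: "integrable circle_measure (poisson (of_real r * \<zeta>))"
    using integrable_poisson_mult[of "\<lambda>_. 1::real" 1, OF _ _ z] by simp
  have "norm (poisson_int \<phi> r \<zeta>) \<le> (\<integral>w. C * poisson (of_real r * \<zeta>) w \<partial>circle_measure)"
    unfolding poisson_int_def
  proof (rule Bochner_Integration.integral_norm_bound_integral[OF integrable_poisson_mult[OF \<phi> z]])
    show "integrable circle_measure (\<lambda>w. C * poisson (of_real r * \<zeta>) w)" using ip by simp
    fix w assume "w \<in> space circle_measure"
    then show "norm (\<phi> w * of_real (poisson (of_real r * \<zeta>) w)) \<le> C * poisson (of_real r * \<zeta>) w"
      using poisson_nonneg[of "of_real r * \<zeta>" w] z \<phi>(2)[of w]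
      by (auto simp: norm_mult intro!: mult_right_mono)
  qed
  also have "\<dots> = C" using integral_poisson[OF z] by simp
  finally show ?thesis .
qed

text \<open>Truncating the Fourier series of the Poisson kernel exhibits \<open>poisson_int \<phi> r\<close> as a uniform
  limit of trigonometric polynomials.\<close>

lemma poisson_int_trig_approx:
  assumes \<phi>: "\<phi> \<in> borel_measurable circle_measure" "\<And>w. norm w = 1 \<Longrightarrow> norm (\<phi> w) \<le> C"
    and r: "0 < r" "r < 1" and \<zeta>: "norm \<zeta> = 1"
  shows "norm (poisson_int \<phi> r \<zeta> - ((\<integral>w. \<phi> w \<partial>circle_measure) +
      (\<Sum>k=1..K. of_real r ^ k * (\<integral>w. \<phi> w * w ^ k \<partial>circle_measure) * cnj (\<zeta> ^ k) +
                 of_real r ^ k * (\<integral>w. \<phi> w * cnj (w ^ k) \<partial>circle_measure) * \<zeta> ^ k)))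
    \<le> C * (2 * r ^ Suc K / (1 - r))"
proof -
  define z where "z = of_real r * \<zeta>"
  have z: "norm z < 1" "norm z = r" using r \<zeta> by (auto simp: z_def norm_mult)
  have C: "0 \<le> C" using \<phi>(2)[of 1] norm_ge_zero order_trans by (metis norm_one)
  let ?M = circle_measure
  let ?t = "\<lambda>w. Re (1 + 2 * (\<Sum>k=1..K. (cnj z * w) ^ k))"
  have i0: "integrable ?M \<phi>" by (rule circle_integrable_bounded[OF \<phi>])
  have pm: "(\<lambda>w. w ^ k) \<in> borel_measurable ?M" "(\<lambda>w. cnj (w ^ k)) \<in> borel_measurable ?M" for k
    by (intro borel_measurable_circle_continuous continuous_intros)+
  have i1: "integrable ?M (\<lambda>w. \<phi> w * w ^ k)" for k
    by (rule circle_integrable_bounded[of _ C]) (use \<phi> pm in \<open>auto simp: norm_mult norm_power\<close>)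
  have i2: "integrable ?M (\<lambda>w. \<phi> w * cnj (w ^ k))" for k
    by (rule circle_integrable_bounded[of _ C]) (use \<phi> pm in \<open>auto simp: norm_mult norm_power\<close>)
  have i3: "integrable ?M (\<lambda>w. \<phi> w * of_real (poisson z w))"
    by (rule integrable_poisson_mult[OF \<phi> z(1)])
  let ?s = "\<lambda>k w. of_real r ^ k * cnj (\<zeta> ^ k) * (\<phi> w * w ^ k) + of_real r ^ k * \<zeta> ^ k * (\<phi> w * cnj (w ^ k))"
  \<comment> \<open>Twice a real part is a number plus its conjugate; this separates the positive
    from the negative frequencies.\<close>
  have t: "\<phi> w * of_real (?t w) = \<phi> w + (\<Sum>k=1..K. ?s k w)" for w
  proof -
    have "complex_of_real (?t w) = 1 + (\<Sum>k=1..K. of_real (2 * Re ((cnj z * w) ^ k)))"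
      by (simp add: sum_distrib_left)
    also have "(\<Sum>k=1..K. of_real (2 * Re ((cnj z * w) ^ k))) =
        (\<Sum>k=1..K. of_real r ^ k * cnj (\<zeta> ^ k) * w ^ k + of_real r ^ k * \<zeta> ^ k * cnj (w ^ k))"
    proof (rule sum.cong)
      fix k
      have "complex_of_real (2 * Re ((cnj z * w) ^ k)) = (cnj z * w) ^ k + cnj ((cnj z * w) ^ k)"
        by (rule complex_add_cnj[symmetric])
      then show "complex_of_real (2 * Re ((cnj z * w) ^ k)) = of_real r ^ k * cnj (\<zeta> ^ k) * w ^ k + of_real r ^ k * \<zeta> ^ k * cnj (w ^ k)"
        by (simp add: z_def power_mult_distrib)
    qed simp
    finally have e: "complex_of_real (?t w) =
        1 + (\<Sum>k=1..K. of_real r ^ k * cnj (\<zeta> ^ k) * w ^ k + of_real r ^ k * \<zeta> ^ k * cnj (w ^ k))" .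
    show ?thesis
      by (subst e, unfold distrib_left mult_1_right sum_distrib_left)
         (intro arg_cong2[of _ _ _ _ "(+)"] refl sum.cong, simp_all add: mult_ac)
  qed
  have isum: "integrable ?M (\<lambda>w. \<Sum>k=1..K. ?s k w)"
    using i1 i2 by (intro Bochner_Integration.integrable_sum Bochner_Integration.integrable_add integrable_mult_right)
  have it: "integrable ?M (\<lambda>w. \<phi> w * of_real (?t w))"
    unfolding t by (rule Bochner_Integration.integrable_add[OF i0 isum])
  have "(\<integral>w. \<phi> w * of_real (?t w) \<partial>?M) = (\<integral>w. \<phi> w \<partial>?M) + (\<Sum>k=1..K. (\<integral>w. ?s k w \<partial>?M))"
    unfolding t using i0 i1 i2 isum
    by (subst Bochner_Integration.integral_add[OF i0 isum], subst Bochner_Integration.integral_sum)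
       (auto intro!: Bochner_Integration.integrable_add integrable_mult_right)
  also have "(\<Sum>k=1..K. (\<integral>w. ?s k w \<partial>?M)) =
      (\<Sum>k=1..K. of_real r ^ k * (\<integral>w. \<phi> w * w ^ k \<partial>?M) * cnj (\<zeta> ^ k) + of_real r ^ k * (\<integral>w. \<phi> w * cnj (w ^ k) \<partial>?M) * \<zeta> ^ k)"
  proof (rule sum.cong)
    fix k
    show "(\<integral>w. ?s k w \<partial>?M) = of_real r ^ k * (\<integral>w. \<phi> w * w ^ k \<partial>?M) * cnj (\<zeta> ^ k) + of_real r ^ k * (\<integral>w. \<phi> w * cnj (w ^ k) \<partial>?M) * \<zeta> ^ k"
      by (subst Bochner_Integration.integral_add[OF integrable_mult_right[OF i1] integrable_mult_right[OF i2]])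
         (simp only: integral_mult_right_zero, simp only: mult_ac)
  qed simp
  finally have trig: "(\<integral>w. \<phi> w \<partial>?M) + (\<Sum>k=1..K. of_real r ^ k * (\<integral>w. \<phi> w * w ^ k \<partial>?M) * cnj (\<zeta> ^ k) + of_real r ^ k * (\<integral>w. \<phi> w * cnj (w ^ k) \<partial>?M) * \<zeta> ^ k)
      = (\<integral>w. \<phi> w * of_real (?t w) \<partial>?M)" by (rule sym)
  have "norm (poisson_int \<phi> r \<zeta> - (\<integral>w. \<phi> w * of_real (?t w) \<partial>?M)) =
      norm (\<integral>w. \<phi> w * of_real (poisson z w) - \<phi> w * of_real (?t w) \<partial>?M)"
    unfolding poisson_int_def z_def[symmetric] by (subst Bochner_Integration.integral_diff[OF i3 it]) (rule refl)
  also have "\<dots> \<le> (\<integral>w. C * (2 * r ^ Suc K / (1 - r)) \<partial>?M)"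
  proof (rule Bochner_Integration.integral_norm_bound_integral[OF Bochner_Integration.integrable_diff[OF i3 it]])
    fix w assume "w \<in> space ?M"
    then have w: "norm w = 1" by simp
    have "norm (\<phi> w * of_real (poisson z w) - \<phi> w * of_real (?t w)) = norm (\<phi> w) * \<bar>poisson z w - ?t w\<bar>"
      by (simp only: right_diff_distrib[symmetric] of_real_diff[symmetric] norm_mult norm_of_real)
    also have "\<dots> \<le> C * (2 * r ^ Suc K / (1 - r))"
      using poisson_geometric[OF z(1) w, of K] C \<phi>(2)[OF w] unfolding z(2) by (intro mult_mono) auto
    finally show "norm (\<phi> w * of_real (poisson z w) - \<phi> w * of_real (?t w)) \<le> C * (2 * r ^ Suc K / (1 - r))" .
  qed simp
  also have "\<dots> = C * (2 * r ^ Suc K / (1 - r))" using circle.prob_space by simp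
  finally show ?thesis unfolding trig .
qed

text \<open>On the circle negative powers are conjugates of positive ones, so with
  \<open>averaging_cnj\<close> and \<open>averaging_const\<close> the assumption reaches all
  trigonometric polynomials.\<close>

locale circle_mp_sequence = mp_sequence circle_measure T for T +
  assumes averaging_power: "\<And>k. k \<ge> 1 \<Longrightarrow> averaging (\<lambda>z. z ^ k)"
begin

lemma averaging_poisson_int:
  assumes \<phi>: "\<phi> \<in> borel_measurable circle_measure" "\<And>w. norm w = 1 \<Longrightarrow> norm (\<phi> w) \<le> C"
    and r: "0 < r" "r < 1"
  shows "averaging (poisson_int \<phi> r)"
proof -
  let ?M = circle_measure
  define \<tau> where "\<tau> K \<zeta> = (\<integral>w. \<phi> w \<partial>?M) +
      (\<Sum>k=1..K. of_real r ^ k * (\<integral>w. \<phi> w * w ^ k \<partial>?M) * cnj (\<zeta> ^ k) +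
                 of_real r ^ k * (\<integral>w. \<phi> w * cnj (w ^ k) \<partial>?M) * \<zeta> ^ k)" for K and \<zeta> :: complex
  define \<delta> where "\<delta> K = C * (2 * r ^ Suc K / (1 - r))" for K
  have \<delta>: "\<delta> \<longlonglongrightarrow> 0"
  proof -
    have "(\<lambda>K. C * (2 * r ^ Suc K / (1 - r))) \<longlonglongrightarrow> C * (2 * 0 / (1 - r))"
      using r by (intro tendsto_intros LIMSEQ_power_zero[THEN LIMSEQ_Suc]) auto
    then show ?thesis by (simp add: \<delta>_def[abs_def])
  qed
  have ap: "norm (poisson_int \<phi> r \<zeta> - \<tau> K \<zeta>) \<le> \<delta> K" if "norm \<zeta> = 1" for \<zeta> K
    unfolding \<tau>_def \<delta>_def by (rule poisson_int_trig_approx[OF \<phi> r that])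
  have \<tau>: "averaging (\<tau> K)" for K
    unfolding \<tau>_def
    by (intro averaging_add averaging_const averaging_sum averaging_mult averaging_cnj averaging_power) auto
  have \<tau>m: "\<tau> K \<in> borel_measurable ?M" for K
    using \<tau>[of K] by (simp add: averaging_def square_integrable_def)
  \<comment> \<open>Measurability in the parameter \<open>\<zeta>\<close> comes from the
    approximating trigonometric polynomials, with no recourse to Fubini.\<close>
  have meas: "poisson_int \<phi> r \<in> borel_measurable ?M"
  proof (rule borel_measurable_LIMSEQ_metric[OF \<tau>m])
    fix \<zeta> assume "\<zeta> \<in> space ?M"
    then have "\<forall>\<^sub>F K in sequentially. norm (\<tau> K \<zeta> - poisson_int \<phi> r \<zeta>) \<le> \<delta> K"
      using ap by (simp add: norm_minus_commute)
    then have "(\<lambda>K. \<tau> K \<zeta> - poisson_int \<phi> r \<zeta>) \<longlonglongrightarrow> 0"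
      using \<delta> by (rule Lim_null_comparison)
    then show "(\<lambda>K. \<tau> K \<zeta>) \<longlonglongrightarrow> poisson_int \<phi> r \<zeta>" by (rule LIM_zero_cancel)
  qed
  show ?thesis
  proof (rule averaging_limit[OF _ \<tau>])
    show "square_integrable ?M (poisson_int \<phi> r)"
      by (rule square_integrable_bounded[OF meas, of C]) (use norm_poisson_int_le[OF \<phi> r] in auto)
    have lim: "(\<lambda>n. (\<delta> n)\<^sup>2) \<longlonglongrightarrow> 0" using tendsto_power[OF \<delta>, of 2] by simp
    show "(\<lambda>n. \<integral>x. (norm (poisson_int \<phi> r x - \<tau> n x))\<^sup>2 \<partial>?M) \<longlonglongrightarrow> 0"
    proof (rule tendsto_sandwich[OF _ _ tendsto_const lim])
      have "(\<integral>x. (norm (poisson_int \<phi> r x - \<tau> n x))\<^sup>2 \<partial>?M) \<le> (\<delta> n)\<^sup>2" for n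
      proof -
        have b: "(norm (poisson_int \<phi> r x - \<tau> n x))\<^sup>2 \<le> (\<delta> n)\<^sup>2" if "norm x = 1" for x
          using ap[OF that] by (intro power_mono) auto
        have "(\<integral>x. (norm (poisson_int \<phi> r x - \<tau> n x))\<^sup>2 \<partial>?M) \<le> (\<integral>x. (\<delta> n)\<^sup>2 \<partial>?M)"
        proof (rule integral_mono)
          show "integrable ?M (\<lambda>x. (norm (poisson_int \<phi> r x - \<tau> n x))\<^sup>2)"
            by (rule circle_integrable_bounded[of _ "(\<delta> n)\<^sup>2"]) (use meas \<tau>m b in auto)
        qed (use b in auto)
        then show ?thesis using circle.prob_space by simp
      qed
      then show "\<forall>\<^sub>F n in sequentially. (\<integral>x. (norm (poisson_int \<phi> r x - \<tau> n x))\<^sup>2 \<partial>?M) \<le> (\<delta> n)\<^sup>2" by simp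
    qed simp
  qed
qed

text \<open>The Poisson means of \<open>\<phi>\<close> converge to it almost everywhere by Fatou's
  theorem and share its bound, hence they converge in mean square.\<close>

lemma averaging_bounded:
  assumes \<phi>: "\<phi> \<in> borel_measurable circle_measure" "\<And>w. norm w = 1 \<Longrightarrow> norm (\<phi> w) \<le> C"
  shows "averaging \<phi>"
proof (rule averaging_limit)
  let ?M = circle_measure
  let ?\<psi> = "\<lambda>n. poisson_int \<phi> (rad n)"
  show "square_integrable ?M \<phi>" by (rule square_integrable_bounded[of _ C]) (use \<phi> in auto)
  show av: "averaging (?\<psi> n)" for n by (rule averaging_poisson_int[OF \<phi> rad_bounds])
  have m: "?\<psi> n \<in> borel_measurable ?M" for n
    using av[of n] by (simp add: averaging_def square_integrable_def)
  have "(\<lambda>n. \<integral>x. (norm (\<phi> x - ?\<psi> n x))\<^sup>2 \<partial>?M) \<longlonglongrightarrow> (\<integral>x. 0 \<partial>?M)"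
  proof (rule integral_dominated_convergence[where w="\<lambda>_. (2 * C)\<^sup>2"])
    have "AE x in ?M. ((\<lambda>r. \<integral>w. \<phi> w * of_real (poisson (of_real r * x) w) \<partial>?M) \<longlongrightarrow> \<phi> x) (at_left 1)"
      by (rule fatou_poisson[OF \<phi>])
    then show "AE x in ?M. (\<lambda>n. (norm (\<phi> x - ?\<psi> n x))\<^sup>2) \<longlonglongrightarrow> 0"
    proof eventually_elim
      fix x assume "((\<lambda>r. \<integral>w. \<phi> w * of_real (poisson (of_real r * x) w) \<partial>?M) \<longlongrightarrow> \<phi> x) (at_left 1)"
      then have "(\<lambda>n. ?\<psi> n x) \<longlonglongrightarrow> \<phi> x"
        unfolding poisson_int_def by (rule filterlim_compose[OF _ rad_tendsto])
      then have "(\<lambda>n. (norm (\<phi> x - ?\<psi> n x))\<^sup>2) \<longlonglongrightarrow> (norm (\<phi> x - \<phi> x))\<^sup>2"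
        by (intro tendsto_intros)
      then show "(\<lambda>n. (norm (\<phi> x - ?\<psi> n x))\<^sup>2) \<longlonglongrightarrow> 0" by simp
    qed
    show "AE x in ?M. norm ((norm (\<phi> x - ?\<psi> n x))\<^sup>2) \<le> (2 * C)\<^sup>2" for n
    proof (rule AE_I2)
      fix x assume "x \<in> space ?M"
      then have x: "norm x = 1" by simp
      have "norm (\<phi> x - ?\<psi> n x) \<le> norm (\<phi> x) + norm (?\<psi> n x)" by (rule norm_triangle_ineq4)
      also have "\<dots> \<le> 2 * C"
        using \<phi>(2)[OF x] norm_poisson_int_le[OF \<phi> rad_bounds, of x n] x by simp
      finally have "(norm (\<phi> x - ?\<psi> n x))\<^sup>2 \<le> (2 * C)\<^sup>2" by (intro power_mono) auto
      then show "norm ((norm (\<phi> x - ?\<psi> n x))\<^sup>2) \<le> (2 * C)\<^sup>2" by (simp only: real_norm_def abs_power2)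
    qed
  qed (use \<phi>(1) m in auto)
  then show "(\<lambda>n. \<integral>x. (norm (\<phi> x - ?\<psi> n x))\<^sup>2 \<partial>?M) \<longlonglongrightarrow> 0" by simp
qed

text \<open>Truncation at height \<open>n\<close> gives bounded functions; the squared error is
  dominated by the integrable \<open>(norm (\<phi> x))\<^sup>2\<close>.\<close>

theorem averaging_square_integrable:
  assumes \<phi>: "square_integrable circle_measure \<phi>"
  shows "averaging \<phi>"
proof (rule averaging_limit[OF \<phi>])
  let ?M = circle_measure
  let ?\<psi> = "\<lambda>(n::nat) x. if norm (\<phi> x) \<le> real n then \<phi> x else 0"
  have \<phi>m [measurable]: "\<phi> \<in> borel_measurable ?M" using \<phi> by (simp add: square_integrable_def)
  have m: "?\<psi> n \<in> borel_measurable ?M" for n by measurable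
  show "averaging (?\<psi> n)" for n
    by (rule averaging_bounded[OF m, of _ "real n"]) auto
  have "(\<lambda>n. \<integral>x. (norm (\<phi> x - ?\<psi> n x))\<^sup>2 \<partial>?M) \<longlonglongrightarrow> (\<integral>x. 0 \<partial>?M)"
  proof (rule integral_dominated_convergence[where w="\<lambda>x. (norm (\<phi> x))\<^sup>2"])
    show "integrable ?M (\<lambda>x. (norm (\<phi> x))\<^sup>2)" using \<phi> by (simp add: square_integrable_def)
    show "AE x in ?M. (\<lambda>n. (norm (\<phi> x - ?\<psi> n x))\<^sup>2) \<longlonglongrightarrow> 0"
    proof (rule AE_I2)
      fix x
      obtain n0 :: nat where "norm (\<phi> x) \<le> real n0" using real_arch_simple by blast
      then show "(\<lambda>n. (norm (\<phi> x - ?\<psi> n x))\<^sup>2) \<longlonglongrightarrow> 0"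
        by (intro tendsto_eventually eventually_sequentiallyI[of n0]) auto
    qed
    show "AE x in ?M. norm ((norm (\<phi> x - ?\<psi> n x))\<^sup>2) \<le> (norm (\<phi> x))\<^sup>2" for n
      by (rule AE_I2) auto
  qed (use m in measurable)
  then show "(\<lambda>n. \<integral>x. (norm (\<phi> x - ?\<psi> n x))\<^sup>2 \<partial>?M) \<longlonglongrightarrow> 0" by simp
qed

end

section \<open>Sequences of compositions of inner functions\<close>

lemma inner_id: "inner_function id"
proof -
  have "has_radial_limit id \<zeta> \<zeta>" for \<zeta>
  proof -
    have "((\<lambda>r. complex_of_real r * \<zeta>) \<longlongrightarrow> of_real 1 * \<zeta>) (at_left 1)"
      by (intro tendsto_intros)
    then show ?thesis by (simp add: has_radial_limit_def)
  qed
  moreover have "AE \<zeta> in circle_measure. norm \<zeta> = 1" by (rule AE_I2) simp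
  ultimately show ?thesis
    unfolding inner_function_def by (auto simp: holomorphic_on_id elim: eventually_mono)
qed

lemma comp_seq_split: "m \<le> n \<Longrightarrow> comp_seq g 0 n = comp_seq g m n \<circ> comp_seq g 0 m"
  by (induction n rule: dec_induct) (simp_all add: comp_seq_Suc o_assoc)

lemma integral_circle_power:
  assumes "k \<ge> 1"
  shows "(\<integral>z. z ^ k \<partial>circle_measure) = 0"
proof -
  have "(\<integral>z. z ^ k \<partial>circle_measure) = (\<integral>z. z ^ k * of_real (poisson 0 z) \<partial>circle_measure)"
    by (rule Bochner_Integration.integral_cong) (auto simp: poisson_def)
  also have "\<dots> = 0 ^ k"
    by (rule poisson_integral_closed_disc) (auto intro!: continuous_intros holomorphic_intros)
  finally show ?thesis using assms by simp
qed

text \<open>A Cesaro argument: apart from finitely many terms, \<open>\<bar>c n\<bar>\<close> is at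
  most \<open>e / 2 * real N\<close>, and there are at most \<open>N\<close> such terms. In the
  ergodic argument \<open>c n\<close> is the increment of the squared norm of the sum.\<close>

lemma sum_div_square_tendsto_0:
  fixes c :: "nat \<Rightarrow> real"
  assumes "(\<lambda>n. c n / real n) \<longlonglongrightarrow> 0"
  shows "(\<lambda>N. (\<Sum>n=1..N. c n) / (real N)\<^sup>2) \<longlonglongrightarrow> 0"
proof (rule tendstoI)
  fix e :: real assume e: "e > 0"
  have "\<forall>\<^sub>F n in sequentially. dist (c n / real n) 0 < e / 2"
    using assms e by (intro tendstoD) auto
  then obtain n0 where n0: "\<And>n. n \<ge> n0 \<Longrightarrow> \<bar>c n / real n\<bar> < e / 2"
    by (auto simp: eventually_sequentially)
  define K where "K = (\<Sum>n=1..n0. \<bar>c n\<bar>)"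
  have b: "\<bar>\<Sum>n=1..N. c n\<bar> \<le> K + e / 2 * (real N)\<^sup>2" for N
  proof -
    have c: "\<bar>c n\<bar> \<le> (if n \<le> n0 then \<bar>c n\<bar> else 0) + e / 2 * real N" if n: "n \<in> {1..N}" for n
    proof (cases "n \<le> n0")
      case False
      then have "\<bar>c n\<bar> / real n < e / 2" using n0[of n] by simp
      then have "\<bar>c n\<bar> \<le> e / 2 * real n" using n by (simp add: field_simps)
      also have "\<dots> \<le> e / 2 * real N" using n e by (intro mult_left_mono) auto
      finally show ?thesis using False by simp
    qed (use e in auto)
    have "\<bar>\<Sum>n=1..N. c n\<bar> \<le> (\<Sum>n=1..N. \<bar>c n\<bar>)" by (rule sum_abs)
    also have "\<dots> \<le> (\<Sum>n=1..N. (if n \<le> n0 then \<bar>c n\<bar> else 0) + e / 2 * real N)"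
      by (rule sum_mono) (rule c)
    also have "\<dots> = (\<Sum>n=1..N. if n \<le> n0 then \<bar>c n\<bar> else 0) + e / 2 * (real N)\<^sup>2"
      by (simp add: sum.distrib power2_eq_square)
    also have "(\<Sum>n=1..N. if n \<le> n0 then \<bar>c n\<bar> else 0) = (\<Sum>n\<in>{n \<in> {1..N}. n \<le> n0}. \<bar>c n\<bar>)"
      by (rule sum.inter_filter[symmetric]) simp
    also have "\<dots> \<le> K" unfolding K_def by (intro sum_mono2) auto
    finally show ?thesis by simp
  qed
  have "(\<lambda>N. K / (real N)\<^sup>2) \<longlonglongrightarrow> 0" by real_asymp
  then have "\<forall>\<^sub>F N in sequentially. K / (real N)\<^sup>2 < e / 2" using e by (intro order_tendstoD(2)) auto
  then show "\<forall>\<^sub>F N in sequentially. dist ((\<Sum>n=1..N. c n) / (real N)\<^sup>2) 0 < e"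
    using eventually_ge_at_top[of 1]
  proof eventually_elim
    fix N :: nat assume N: "K / (real N)\<^sup>2 < e / 2" "1 \<le> N"
    have "\<bar>\<Sum>n=1..N. c n\<bar> / (real N)\<^sup>2 \<le> (K + e / 2 * (real N)\<^sup>2) / (real N)\<^sup>2"
      using b by (intro divide_right_mono) auto
    also have "\<dots> = K / (real N)\<^sup>2 + e / 2" using N(2) by (simp add: add_divide_distrib)
    also have "\<dots> < e" using N(1) by linarith
    finally show "dist ((\<Sum>n=1..N. c n) / (real N)\<^sup>2) 0 < e" by simp
  qed
qed

locale inner_sequence =
  fixes g :: "nat \<Rightarrow> complex \<Rightarrow> complex"
  assumes inner: "\<And>n. n \<ge> 1 \<Longrightarrow> inner_function (g n)" and fix0: "\<And>n. n \<ge> 1 \<Longrightarrow> g n 0 = 0"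
begin

lemma inner_comp_seq:
  assumes "m \<le> n"
  shows "inner_function (comp_seq g m n)" and "comp_seq g m n 0 = 0"
proof -
  have "inner_function (comp_seq g m n) \<and> comp_seq g m n 0 = 0"
    using assms
  proof (induction n rule: dec_induct)
    case base
    have "comp_seq g m m = id" by (rule comp_seq_self)
    then show ?case by (simp only:) (rule conjI[OF inner_id id_apply])
  next
    case (step n)
    then have h: "inner_function (comp_seq g m n)" "comp_seq g m n 0 = 0" by auto
    show ?case
      unfolding comp_seq_Suc[OF step.hyps(1)]
    proof
      show "inner_function (g (Suc n) \<circ> comp_seq g m n)"
        by (rule inner_compose(1)[OF h inner]) simp
    qed (simp add: h fix0)
  qed
  then show "inner_function (comp_seq g m n)" "comp_seq g m n 0 = 0" by auto
qed

text \<open>Index \<open>0\<close> is the boundary map of the empty composition \<open>id\<close>,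
  so that \<open>m = 0\<close> in (b) is an ordinary case of \<open>correlation\<close>.\<close>

definition T :: "nat \<Rightarrow> complex \<Rightarrow> complex" where
  "T n = boundary_map (comp_seq g 0 n)"

lemma norm_T [simp]: "norm (T n z) = 1"
  by (simp add: T_def)

lemma borel_measurable_T [measurable]: "T n \<in> borel_measurable circle_measure"
  unfolding T_def by (rule borel_measurable_boundary_map[OF inner_comp_seq(1)]) simp

lemma T_preserving: "measure_preserving_map circle_measure (T n)"
  unfolding T_def by (rule measure_preserving_boundary[OF inner_comp_seq]) simp_all

sublocale mp_sequence circle_measure T
  by unfold_locales (rule T_preserving)

lemma correlation:
  assumes "m \<le> n"
  shows "(\<integral>z. T n z ^ l * cnj (T m z ^ l) \<partial>circle_measure) = deriv (comp_seq g m n) 0 ^ l"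
proof -
  let ?h = "comp_seq g m n" and ?M = circle_measure
  have h: "inner_function ?h" "?h 0 = 0" and G: "inner_function (comp_seq g 0 m)" "comp_seq g 0 m 0 = 0"
    using inner_comp_seq assms by auto
  have cm: "(\<lambda>z. cnj (z ^ l)) \<in> borel_measurable ?M"
    by (rule borel_measurable_circle_continuous) (intro continuous_intros)
  have cm': "(\<lambda>z. cnj (z ^ l)) \<in> borel_measurable borel"
    by (intro borel_measurable_continuous_onI continuous_intros)
  have Tm: "T m \<in> ?M \<rightarrow>\<^sub>M ?M" and d: "distr ?M ?M (T m) = ?M"
    using T_preserving[of m] by (auto simp: measure_preserving_map_def)
  have hm: "boundary_map ?h \<in> borel_measurable ?M" by (rule borel_measurable_boundary_map[OF h(1)])
  have fm: "(\<lambda>z. boundary_map ?h z ^ l * cnj (z ^ l)) \<in> borel_measurable ?M"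
    using hm cm by measurable
  have "AE z in ?M. T n z = boundary_map ?h (T m z)"
    using inner_compose(2)[OF G h(1)] unfolding T_def comp_seq_split[OF assms] .
  then have "AE z in ?M. T n z ^ l * cnj (T m z ^ l) = boundary_map ?h (T m z) ^ l * cnj (T m z ^ l)"
    by eventually_elim simp
  then have "(\<integral>z. T n z ^ l * cnj (T m z ^ l) \<partial>?M) = (\<integral>z. boundary_map ?h (T m z) ^ l * cnj (T m z ^ l) \<partial>?M)"
  proof (rule integral_cong_AE[rotated 2])
    show "(\<lambda>z. T n z ^ l * cnj (T m z ^ l)) \<in> borel_measurable ?M"
      using measurable_compose[OF borel_measurable_T cm'] by measurable
    show "(\<lambda>z. boundary_map ?h (T m z) ^ l * cnj (T m z ^ l)) \<in> borel_measurable ?M"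
      using measurable_compose[OF Tm fm] by simp
  qed
  also have "\<dots> = (\<integral>z. boundary_map ?h z ^ l * cnj (z ^ l) \<partial>?M)"
    using integral_distr[OF Tm fm] unfolding d by simp
  also have "\<dots> = deriv ?h 0 ^ l" by (rule fourier_coefficient_boundary[OF h])
  finally show ?thesis .
qed

lemma integrable_correlation: "integrable circle_measure (\<lambda>z. T n z ^ l * cnj (T m z ^ l))"
proof (rule circle_integrable_bounded[of _ 1])
  have "(\<lambda>z. cnj (z ^ l)) \<in> borel_measurable borel"
    by (intro borel_measurable_continuous_onI continuous_intros)
  from measurable_compose[OF borel_measurable_T this]
  show "(\<lambda>z. T n z ^ l * cnj (T m z ^ l)) \<in> borel_measurable circle_measure" by measurable
qed (simp add: norm_mult norm_power)

text \<open>Diagonal terms are \<open>1\<close> because the values have modulus one; each pair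
  \<open>m < n\<close> occurs together with its conjugate, whence twice the real part. Grouping by
  the larger index produces exactly the inner sums of the hypothesis of (a).\<close>

lemma integral_sum_square:
  "(\<integral>z. (norm (\<Sum>n=1..N. T n z ^ k))\<^sup>2 \<partial>circle_measure) =
    (\<Sum>n=1..N. 1 + 2 * Re (\<Sum>m=1..<n. deriv (comp_seq g m n) 0 ^ k))"
proof (induction N)
  case (Suc N)
  let ?M = circle_measure
  let ?S = "\<lambda>z. \<Sum>n=1..N. T n z ^ k"
  let ?c = "\<lambda>m z. T (Suc N) z ^ k * cnj (T m z ^ k)"
  have Sm: "?S \<in> borel_measurable ?M" by measurable
  have Sb: "norm (?S z) \<le> real N" for z
    using norm_sum[of "\<lambda>n. T n z ^ k" "{1..N}"] by (simp add: norm_power)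
  have iS: "integrable ?M (\<lambda>z. (norm (?S z))\<^sup>2)"
    by (rule circle_integrable_bounded[of _ "(real N)\<^sup>2"]) (use Sm Sb in \<open>auto intro!: power_mono\<close>)
  have ic: "integrable ?M (\<lambda>z. \<Sum>m=1..N. ?c m z)"
    by (intro Bochner_Integration.integrable_sum integrable_correlation)
  have sq: "(norm (\<Sum>n=1..Suc N. T n z ^ k))\<^sup>2 = (norm (?S z))\<^sup>2 + (1 + 2 * Re (\<Sum>m=1..N. ?c m z))" for z
  proof -
    have *: "(norm (a + b))\<^sup>2 = (norm a)\<^sup>2 + ((norm b)\<^sup>2 + 2 * Re (b * cnj a))" for a b :: complex
      unfolding cmod_power2 by (simp add: power2_eq_square algebra_simps)
    have "T (Suc N) z ^ k * cnj (?S z) = (\<Sum>m=1..N. ?c m z)"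
      by (simp add: sum_distrib_left)
    then show ?thesis using *[of "?S z" "T (Suc N) z ^ k"] by (simp add: norm_power)
  qed
  have "(\<integral>z. (norm (\<Sum>n=1..Suc N. T n z ^ k))\<^sup>2 \<partial>?M) =
      (\<integral>z. (norm (?S z))\<^sup>2 \<partial>?M) + (1 + 2 * Re (\<integral>z. (\<Sum>m=1..N. ?c m z) \<partial>?M))"
    unfolding sq using iS ic circle.prob_space
    by (simp only: Bochner_Integration.integral_add Bochner_Integration.integrable_add integral_Re integrable_Re
          integral_mult_right_zero integrable_mult_right circle.integrable_const lebesgue_integral_const real_scaleR_def mult_1)
  also have "(\<integral>z. (\<Sum>m=1..N. ?c m z) \<partial>?M) = (\<Sum>m=1..<Suc N. deriv (comp_seq g m (Suc N)) 0 ^ k)"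
    unfolding atLeastLessThanSuc_atLeastAtMost Bochner_Integration.integral_sum[OF integrable_correlation]
    by (rule sum.cong[OF refl], rule correlation) simp
  finally show ?case unfolding Suc.IH by simp
qed simp

theorem ergodic_if:
  assumes "\<And>l. l \<ge> 1 \<Longrightarrow> (\<lambda>N. (\<Sum>m=1..<N. (deriv (comp_seq g m N) 0) ^ l) / of_nat N) \<longlonglongrightarrow> 0"
  shows "ergodic_sequence circle_measure T"
proof -
  have "averaging (\<lambda>z. z ^ k)" if k: "k \<ge> 1" for k
    unfolding averaging_def
  proof
    have "(\<lambda>z. z ^ k) \<in> borel_measurable circle_measure"
      by (rule borel_measurable_circle_continuous) (intro continuous_intros)
    then show "square_integrable circle_measure (\<lambda>z. z ^ k)"
      by (rule circle.square_integrable_bounded[of _ 1]) (simp add: norm_power)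
    \<comment> \<open>By the hypothesis \<open>?c n / real n\<close> tends to zero, the diagonal
      contributing only \<open>1 / real n\<close>.\<close>
    let ?c = "\<lambda>n. 1 + 2 * Re (\<Sum>m=1..<n. deriv (comp_seq g m n) 0 ^ k)"
    have dev: "(\<integral>z. (norm (deviation (\<lambda>z. z ^ k) N z))\<^sup>2 \<partial>circle_measure) = (\<Sum>n=1..N. ?c n) / (real N)\<^sup>2" for N
    proof -
      have "(norm (deviation (\<lambda>z. z ^ k) N z))\<^sup>2 = (norm (\<Sum>n=1..N. T n z ^ k))\<^sup>2 / (real N)\<^sup>2" for z
        using integral_circle_power[OF k] by (simp add: deviation_def norm_divide power_divide)
      then show ?thesis using integral_sum_square[where k=k and N=N] by simp
    qed
    have "(\<lambda>n. 1 / real n + 2 * Re ((\<Sum>m=1..<n. deriv (comp_seq g m n) 0 ^ k) / of_nat n)) \<longlonglongrightarrow> 0 + 2 * Re 0"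
      by (intro tendsto_add tendsto_mult_left tendsto_Re assms k) real_asymp
    moreover have "1 / real n + 2 * Re ((\<Sum>m=1..<n. deriv (comp_seq g m n) 0 ^ k) / of_nat n) = ?c n / real n" for n
      using Re_divide_of_real[of "\<Sum>m=1..<n. deriv (comp_seq g m n) 0 ^ k" "real n"]
      by (simp add: add_divide_distrib)
    ultimately have "(\<lambda>n. ?c n / real n) \<longlonglongrightarrow> 0" by simp
    from sum_div_square_tendsto_0[OF this]
    show "(\<lambda>N. \<integral>z. (norm (deviation (\<lambda>z. z ^ k) N z))\<^sup>2 \<partial>circle_measure) \<longlonglongrightarrow> 0"
      unfolding dev .
  qed
  then interpret circle_mp_sequence T by unfold_locales
  show ?thesis
    unfolding ergodic_iff_averaging using averaging_square_integrable by blast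
qed

theorem ergodic_only_if:
  assumes erg: "ergodic_sequence circle_measure T" and l: "l \<ge> 1"
  shows "(\<lambda>N. (\<Sum>n=m+1..N. (deriv (comp_seq g m n) 0) ^ l) / of_nat N) \<longlonglongrightarrow> 0"
proof -
  let ?M = circle_measure
  let ?A = "deviation (\<lambda>z. z ^ l)"
  let ?c = "\<lambda>n. \<integral>z. T n z ^ l * cnj (T m z ^ l) \<partial>?M"
  have pm: "(\<lambda>z. z ^ l) \<in> borel_measurable ?M" "(\<lambda>z. cnj (z ^ l)) \<in> borel_measurable borel"
    by (rule borel_measurable_circle_continuous, intro continuous_intros)
       (intro borel_measurable_continuous_onI continuous_intros)
  have sq: "square_integrable ?M (\<lambda>z. z ^ l)"
    by (rule circle.square_integrable_bounded[OF pm(1), of 1]) (simp add: norm_power)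
  have lim: "(\<lambda>N. \<integral>z. (norm (?A N z))\<^sup>2 \<partial>?M) \<longlonglongrightarrow> 0"
    using erg sq unfolding ergodic_iff_averaging averaging_def by blast
  have A: "?A N z = (\<Sum>n=1..N. T n z ^ l) / of_nat N" for N z
    using integral_circle_power[OF l] by (simp add: deviation_def)
  have ym: "(\<lambda>z. cnj (T m z ^ l)) \<in> borel_measurable ?M"
    by (rule measurable_compose[OF borel_measurable_T pm(2)])
  have sA: "square_integrable ?M (\<lambda>z. ?A N z * cnj (T m z ^ l))" for N
    using square_integrable_deviation[OF sq, of N] ym
    by (auto simp: square_integrable_def norm_mult norm_power)
  have avg: "(\<integral>z. ?A N z * cnj (T m z ^ l) \<partial>?M) = (\<Sum>n=1..N. ?c n) / of_nat N" for N
  proof -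
    have "(\<integral>z. ?A N z * cnj (T m z ^ l) \<partial>?M) = (\<integral>z. (\<Sum>n=1..N. T n z ^ l * cnj (T m z ^ l)) / of_nat N \<partial>?M)"
      unfolding A by (simp only: times_divide_eq_left sum_distrib_right)
    also have "\<dots> = (\<Sum>n=1..N. ?c n) / of_nat N"
      by (simp only: integral_divide_zero Bochner_Integration.integral_sum[OF integrable_correlation])
    finally show ?thesis .
  qed
  \<comment> \<open>The factor paired with the average has modulus one, so it drops out of the mean
    square.\<close>
  have bound: "(norm ((\<Sum>n=1..N. ?c n) / of_nat N))\<^sup>2 \<le> (\<integral>z. (norm (?A N z))\<^sup>2 \<partial>?M)" for N
    using circle.norm_integral_square_le[OF sA[of N]] unfolding avg by (simp add: norm_mult norm_power)
  have "(\<lambda>N. (norm ((\<Sum>n=1..N. ?c n) / of_nat N))\<^sup>2) \<longlonglongrightarrow> 0"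
    by (rule tendsto_sandwich[OF _ _ tendsto_const lim]) (use bound in auto)
  from tendsto_real_sqrt[OF this] have c0: "(\<lambda>N. (\<Sum>n=1..N. ?c n) / of_nat N) \<longlonglongrightarrow> 0"
    by (simp add: tendsto_norm_zero_iff)
  \<comment> \<open>The indices up to \<open>m\<close> form a sum independent of \<open>N\<close>,
    which division by \<open>N\<close> makes negligible. Subtracting it leaves, for
    \<open>N \<ge> m\<close>, only indices \<open>n > m\<close>, where \<open>correlation\<close>
    applies.\<close>
  have "(\<lambda>N. (\<Sum>n=1..m. ?c n) / of_nat N) \<longlonglongrightarrow> 0"
    by (rule lim_const_over_n)
  from tendsto_diff[OF c0 this]
  have "(\<lambda>N. (\<Sum>n=1..N. ?c n) / of_nat N - (\<Sum>n=1..m. ?c n) / of_nat N) \<longlonglongrightarrow> 0" by simp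
  moreover have "\<forall>\<^sub>F N in sequentially. (\<Sum>n=1..N. ?c n) / of_nat N - (\<Sum>n=1..m. ?c n) / of_nat N =
      (\<Sum>n=m+1..N. (deriv (comp_seq g m n) 0) ^ l) / of_nat N"
  proof (rule eventually_sequentiallyI[of m])
    fix N assume "m \<le> N"
    then have "(\<Sum>n=1..N. ?c n) = (\<Sum>n=1..m. ?c n) + (\<Sum>n=m+1..N. ?c n)"
      using sum.ub_add_nat[of 1 m ?c "N - m"] by simp
    moreover have "(\<Sum>n=m+1..N. ?c n) = (\<Sum>n=m+1..N. (deriv (comp_seq g m n) 0) ^ l)"
      by (intro sum.cong correlation) auto
    ultimately show "(\<Sum>n=1..N. ?c n) / of_nat N - (\<Sum>n=1..m. ?c n) / of_nat N =
      (\<Sum>n=m+1..N. (deriv (comp_seq g m n) 0) ^ l) / of_nat N"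
      by (simp flip: diff_divide_distrib)
  qed
  ultimately show ?thesis by (rule Lim_transform_eventually)
qed

end

theorem theorem4p1:
  fixes g :: "nat \<Rightarrow> complex \<Rightarrow> complex"
  assumes "\<And>n. n \<ge> 1 \<Longrightarrow> inner_function (g n)"
    and "\<And>n. n \<ge> 1 \<Longrightarrow> g n 0 = 0"
  shows
    "((\<forall>l::nat. l \<ge> 1 \<longrightarrow>
         (\<lambda>N. (\<Sum>m=1..<N. (deriv (comp_seq g m N) 0) ^ l) / of_nat N) \<longlonglongrightarrow> 0)
       \<longrightarrow> ergodic_sequence circle_measure (\<lambda>n. boundary_map (comp_seq g 0 n)))
     \<and>
     (ergodic_sequence circle_measure (\<lambda>n. boundary_map (comp_seq g 0 n))
       \<longrightarrow> (\<forall>m l::nat. l \<ge> 1 \<longrightarrow>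
         (\<lambda>N. (\<Sum>n=m+1..N. (deriv (comp_seq g m n) 0) ^ l) / of_nat N) \<longlonglongrightarrow> 0))"
proof -
  interpret inner_sequence g by unfold_locales (fact assms)+
  show ?thesis
    using ergodic_if ergodic_only_if unfolding T_def[abs_def] by blast
qed

end
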